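(* Let $(W,S)_B$ be a Lorentzian Coxeter system, with roots $\Phi$ and weights $\Omega$. Then the set of limit weights equals the set of limit roots: $E(\Omega)=E(\Phi)$.
   Context: **Geometric Coxeter system.** $(W,S)$ is a Coxeter system with $S$ finite, $|S|=n$, with relations $(st)^{m_{st}}=e$ ($m_{ss}=1$, $m_{st}=m_{ts}\in\{2,3,\dots\}\cup\{\infty\}$ for $s\neq t$). $B$ is a symmetric matrix with $B_{st}=-\cos(\pi/m_{st})$ if $m_{st}<\infty$ and $B_{st}=-c_{st}$ if $m_{st}=\infty$, where the reals $c_{st}=c_{ts}\ge 1$ are chosen arbitrarily. $V$ is a real vector space with basis $\Delta=\{\alpha_s\}_{s\in S}$ (simple roots), with symmetric bilinear form $\mathcal B(\alpha_s,\alpha_t)=B_{st}$. $W$ acts faithfully on $V$, preserving $\mathcal B$, by $s\mapsto\sigma_{\alpha_s}$, where $\sigma_\alpha(x)=x-2\frac{\mathcal B(x,\alpha)}{\mathcal B(\alpha,\alpha)}\alpha$. The system is *Lorentzian* if $B$ has signature $(n-1,1)$. **Roots and weights.** The set of roots is $\Phi=W(\Delta)$. The fundamental weights $\Delta^*=\{\omega_s\}_{s\in S}\subset V$ are defined by $\mathcal B(\alpha_s,\omega_t)=\delta_{st}$, and the set of weights is $\Omega=W(\Delta^* )$. **Limit roots and limit weights.** For $x\in V\setminus\{0\}$, $\widehat x\in\mathbb PV$ is the line spanned by $x$. For $X=\Phi$ or $X=\Omega$, $E(X)$ is the set of all $\widehat x\in\mathbb PV$ such that there is an injective sequence $(x_i)_{i\in\mathbb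 N}$ of elements of $X$ with $\lim_{i\to\infty}\widehat{x}_i=\widehat x$. Elements of $E(\Phi)$ are called limit roots and elements of $E(\Omega)$ limit weights. *)

theory Defs
  imports
    "HOL-Analysis.Analysis"
    "HOL-Library.Extended_Nat"
    "HOL-Algebra.Generated_Groups"
    "HOL-Algebra.Group_Action"
begin

text \<open>
  Congruence on words generated by the relations \<open>(st)^(m s t) = e\<close> with \<open>m s t\<close> finite.
  Since \<open>m s s = 1\<close> makes every generator its own inverse, words in the generators
  alone (without formal inverses) suffice to present the group.
\<close>
inductive coxeter_cong :: "'w set \<Rightarrow> ('w \<Rightarrow> 'w \<Rightarrow> enat) \<Rightarrow> 'w list \<Rightarrow> 'w list \<Rightarrow> bool"
  for S :: "'w set" and m :: "'w \<Rightarrow> 'w \<Rightarrow> enat"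
where
  relator: "s \<in> S \<Longrightarrow> t \<in> S \<Longrightarrow> m s t = enat k \<Longrightarrow>
    coxeter_cong S m (us @ concat (replicate k [s, t]) @ vs) (us @ vs)"
| refl: "coxeter_cong S m us us"
| sym: "coxeter_cong S m us vs \<Longrightarrow> coxeter_cong S m vs us"
| trans: "coxeter_cong S m us vs \<Longrightarrow> coxeter_cong S m vs ws \<Longrightarrow> coxeter_cong S m us ws"

definition word_value :: "('w, 'x) monoid_scheme \<Rightarrow> 'w list \<Rightarrow> 'w" where
  "word_value W us = foldr (\<lambda>s w. s \<otimes>\<^bsub>W\<^esub> w) us \<one>\<^bsub>W\<^esub>"

locale coxeter_system = group W
  for W :: "('w, 'x) monoid_scheme" (structure) +
  fixes S :: "'w set" and m :: "'w \<Rightarrow> 'w \<Rightarrow> enat"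
  assumes finite_S: "finite S"
    and S_subset: "S \<subseteq> carrier W"
    and m_diag: "\<And>s. s \<in> S \<Longrightarrow> m s s = 1"
    and m_sym: "\<And>s t. s \<in> S \<Longrightarrow> t \<in> S \<Longrightarrow> m s t = m t s"
    and m_ge_2: "\<And>s t. s \<in> S \<Longrightarrow> t \<in> S \<Longrightarrow> s \<noteq> t \<Longrightarrow> 2 \<le> m s t"
    and generated: "generate W S = carrier W"
    and presentation: "\<And>us vs. us \<in> lists S \<Longrightarrow> vs \<in> lists S \<Longrightarrow>
      word_value W us = word_value W vs \<longleftrightarrow> coxeter_cong S m us vs"

definition coxeter_entry :: "('w \<Rightarrow> 'w \<Rightarrow> enat) \<Rightarrow> ('w \<Rightarrow> 'w \<Rightarrow> real) \<Rightarrow> 'w \<Rightarrow> 'w \<Rightarrow> real" where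
  "coxeter_entry m c s t =
    (case m s t of enat k \<Rightarrow> - cos (pi / real k) | \<infinity> \<Rightarrow> - c s t)"

definition form_reflection :: "('v::real_vector \<Rightarrow> 'v \<Rightarrow> real) \<Rightarrow> 'v \<Rightarrow> 'v \<Rightarrow> 'v" where
  "form_reflection b a x = x - (2 * (b x a / b a a)) *\<^sub>R a"

text \<open>
  The space \<open>V\<close> is the whole type \<open>'v\<close>; the class \<^class>\<open>euclidean_space\<close> is used only for
  finite-dimensionality and the canonical topology, its inner product being unrelated
  to the form \<open>b\<close>. The action \<open>\<rho>\<close> is determined by its values on \<open>S\<close>.
\<close>
locale geometric_coxeter_system = coxeter_system W S m + group_action W UNIV \<rho>
  for W :: "('w, 'x) monoid_scheme" (structure)
    and S :: "'w set" and m :: "'w \<Rightarrow> 'w \<Rightarrow> enat"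
    and \<rho> :: "'w \<Rightarrow> 'v::euclidean_space \<Rightarrow> 'v" +
  fixes c :: "'w \<Rightarrow> 'w \<Rightarrow> real"
    and \<alpha> :: "'w \<Rightarrow> 'v"
    and b :: "'v \<Rightarrow> 'v \<Rightarrow> real"
  assumes c_sym: "\<And>s t. s \<in> S \<Longrightarrow> t \<in> S \<Longrightarrow> m s t = \<infinity> \<Longrightarrow> c s t = c t s"
    and c_ge_1: "\<And>s t. s \<in> S \<Longrightarrow> t \<in> S \<Longrightarrow> m s t = \<infinity> \<Longrightarrow> 1 \<le> c s t"
    and simple_inj: "inj_on \<alpha> S"
    and simple_independent: "independent (\<alpha> ` S)"
    and simple_span: "span (\<alpha> ` S) = UNIV"
    and form_bilinear: "bilinear b"
    and form_sym: "\<And>x y. b x y = b y x"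
    and form_simple: "\<And>s t. s \<in> S \<Longrightarrow> t \<in> S \<Longrightarrow> b (\<alpha> s) (\<alpha> t) = coxeter_entry m c s t"
    and action_simple: "\<And>s. s \<in> S \<Longrightarrow> \<rho> s = form_reflection b (\<alpha> s)"

text \<open>Signature \<open>(p, q)\<close> in the sense of Sylvester: some orthogonal basis has exactly \<open>p\<close>
  vectors of positive and \<open>q\<close> vectors of negative square.\<close>
definition has_signature :: "('v::euclidean_space \<Rightarrow> 'v \<Rightarrow> real) \<Rightarrow> nat \<Rightarrow> nat \<Rightarrow> bool" where
  "has_signature b p q \<longleftrightarrow>
    (\<exists>E. independent E \<and> span E = UNIV \<and>
      (\<forall>x\<in>E. \<forall>y\<in>E. x \<noteq> y \<longrightarrow> b x y = 0) \<and>
      card {x \<in> E. b x x > 0} = p \<and> card {x \<in> E. b x x < 0} = q)"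

text \<open>The truncated subtraction is harmless: a signature \<open>(p, 1)\<close> forces \<open>S\<close> to be nonempty.\<close>
locale lorentzian_coxeter_system = geometric_coxeter_system W S m \<rho> c \<alpha> b
  for W :: "('w, 'x) monoid_scheme" (structure)
    and S :: "'w set" and m :: "'w \<Rightarrow> 'w \<Rightarrow> enat"
    and \<rho> :: "'w \<Rightarrow> 'v::euclidean_space \<Rightarrow> 'v"
    and c :: "'w \<Rightarrow> 'w \<Rightarrow> real"
    and \<alpha> :: "'w \<Rightarrow> 'v"
    and b :: "'v \<Rightarrow> 'v \<Rightarrow> real" +
  assumes lorentzian: "has_signature b (card S - 1) 1"

definition orbit_set ::
  "('w, 'x) monoid_scheme \<Rightarrow> ('w \<Rightarrow> 'v \<Rightarrow> 'v) \<Rightarrow> 'v set \<Rightarrow> 'v set" where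
  "orbit_set W \<rho> X = (\<Union>w\<in>carrier W. \<rho> w ` X)"

definition roots ::
  "('w, 'x) monoid_scheme \<Rightarrow> 'w set \<Rightarrow> ('w \<Rightarrow> 'v \<Rightarrow> 'v) \<Rightarrow> ('w \<Rightarrow> 'v) \<Rightarrow> 'v set" where
  "roots W S \<rho> \<alpha> = orbit_set W \<rho> (\<alpha> ` S)"

text \<open>Well defined as soon as \<open>b\<close> is nondegenerate, in particular for Lorentzian systems.\<close>
definition fundamental_weight ::
  "'w set \<Rightarrow> ('w \<Rightarrow> 'v) \<Rightarrow> ('v \<Rightarrow> 'v \<Rightarrow> real) \<Rightarrow> 'w \<Rightarrow> 'v" where
  "fundamental_weight S \<alpha> b t =
    (THE x. \<forall>s\<in>S. b (\<alpha> s) x = (if s = t then 1 else 0))"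

definition weights ::
  "('w, 'x) monoid_scheme \<Rightarrow> 'w set \<Rightarrow> ('w \<Rightarrow> 'v \<Rightarrow> 'v) \<Rightarrow> ('w \<Rightarrow> 'v) \<Rightarrow>
    ('v \<Rightarrow> 'v \<Rightarrow> real) \<Rightarrow> 'v set" where
  "weights W S \<rho> \<alpha> b = orbit_set W \<rho> (fundamental_weight S \<alpha> b ` S)"

definition proj_line :: "'v::real_vector \<Rightarrow> 'v set" where
  "proj_line x = span {x}"

text \<open>Points of projective space are the lines through the origin, with the quotient
  topology from the nonzero vectors.\<close>
definition proj_topology :: "'v::euclidean_space set topology" where
  "proj_topology = topology (\<lambda>U. U \<subseteq> proj_line ` (UNIV - {0}) \<and>
    open {x. x \<noteq> 0 \<and> proj_line x \<in> U})"

lemma openin_proj_topology: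
  "openin proj_topology U \<longleftrightarrow>
    U \<subseteq> proj_line ` (UNIV - {0}) \<and> open {x::'v::euclidean_space. x \<noteq> 0 \<and> proj_line x \<in> U}"
proof -
  let ?P = "\<lambda>U. U \<subseteq> proj_line ` (UNIV - {0}) \<and> open {x::'v. x \<noteq> 0 \<and> proj_line x \<in> U}"
  have "?P (U \<inter> V)" if "?P U" "?P V" for U V
  proof -
    have "{x. x \<noteq> 0 \<and> proj_line x \<in> U \<inter> V} =
        {x. x \<noteq> 0 \<and> proj_line x \<in> U} \<inter> {x. x \<noteq> 0 \<and> proj_line x \<in> V}"
      by auto
    then show ?thesis using that by (auto intro: open_Int)
  qed
  moreover have "?P (\<Union>K)" if "\<forall>U\<in>K. ?P U" for K
  proof -
    have "{x. x \<noteq> 0 \<and> proj_line x \<in> \<Union>K} = (\<Union>U\<in>K. {x. x \<noteq> 0 \<and> proj_line x \<in> U})"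
      by auto
    moreover have "open (\<Union>U\<in>K. {x. x \<noteq> 0 \<and> proj_line x \<in> U})"
      using that by blast
    ultimately show ?thesis using that by (simp add: Sup_le_iff)
  qed
  ultimately have "istopology ?P"
    unfolding istopology_def by blast
  then show ?thesis
    unfolding proj_topology_def by (simp add: topology_inverse')
qed

lemma topspace_proj_topology:
  "topspace (proj_topology :: 'v::euclidean_space set topology) = proj_line ` (UNIV - {0})"
proof (rule antisym)
  show "topspace (proj_topology :: 'v set topology) \<subseteq> proj_line ` (UNIV - {0})"
    unfolding topspace_def by (auto simp: openin_proj_topology)
  have "{x::'v. x \<noteq> 0 \<and> proj_line x \<in> proj_line ` (UNIV - {0})} = UNIV - {0}"
    by auto
  then have "openin (proj_topology :: 'v set topology) (proj_line ` (UNIV - {0}))"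
    by (simp add: openin_proj_topology open_delete)
  then show "proj_line ` (UNIV - {0}) \<subseteq> topspace (proj_topology :: 'v set topology)"
    by (rule openin_subset)
qed

lemma quotient_map_proj_line:
  "quotient_map (top_of_set (UNIV - {0::'v::euclidean_space})) proj_topology proj_line"
proof -
  have "{x \<in> UNIV - {0::'v}. proj_line x \<in> U} = {x. x \<noteq> 0 \<and> proj_line x \<in> U}" for U
    by auto
  moreover have "openin (top_of_set (UNIV - {0::'v})) A \<longleftrightarrow> A \<subseteq> UNIV - {0} \<and> open A" for A
    by (subst openin_open_eq) (auto simp: open_delete)
  ultimately show ?thesis
    unfolding quotient_map_def by (auto simp: topspace_proj_topology openin_proj_topology)
qed

definition limit_directions :: "'v::euclidean_space set \<Rightarrow> 'v set set" where
  "limit_directions X = {proj_line x | x. x \<noteq> 0 \<and>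
    (\<exists>xs :: nat \<Rightarrow> 'v. inj xs \<and> range xs \<subseteq> X \<and>
      limitin proj_topology (\<lambda>i. proj_line (xs i)) (proj_line x) sequentially)}"

end

theory Submission
  imports Defs
begin

text \<open>
  Let \<open>u\<close> be a timelike vector in the interior of the fundamental chamber. Both sets of limit
  directions are shown to agree with the limit directions of the orbit \<open>W u\<close>. The tool
  throughout is that orthogonal isotropic vectors are proportional: if \<open>x\<^sub>i\<close>, \<open>y\<^sub>i\<close> have
  bounded squares, \<open>b(u, x\<^sub>i)\<close> and \<open>b(u, y\<^sub>i)\<close> tend to infinity and \<open>b(x\<^sub>i, y\<^sub>i)\<close> is bounded, then
  \<open>x\<^sub>i\<close> and \<open>y\<^sub>i\<close> have the same limit directions. Taking \<open>x\<^sub>i = w\<^sub>i u\<close> and \<open>y\<^sub>i = w\<^sub>i p\<close>, where \<open>p\<close> is a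
  simple root or a fundamental weight, limit directions of \<open>W u\<close> are limit roots and limit weights.
  Conversely, a limit root is a limit of the reflections of \<open>u\<close> in the roots. For a sequence of
  weights \<open>x\<^sub>i\<close> in the orbit of \<open>\<omega>\<close> with limit direction \<open>z\<close>, all \<open>\<omega> - w x\<^sub>i\<close> are nonnegative combinations of simple roots,
  so \<open>-z\<close> and all its images under \<open>W\<close> lie in the cone spanned by the simple roots; an isotropic
  vector of this kind is a limit direction of \<open>W u\<close>. The discreteness of the orbits comes from a gap:
  the nonzero coefficients of a positive root are at least 1.
\<close>

section \<open>Convergence of lines\<close>

lemma proj_line_scaleR: "k \<noteq> 0 \<Longrightarrow> proj_line (k *\<^sub>R x) = proj_line x"
  unfolding proj_line_def
  using span_image_scale[of "{x}" "\<lambda>_. k"] by simp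

lemma mem_proj_line: "x \<in> proj_line x"
  unfolding proj_line_def by (rule span_base) simp

lemma limitin_proj_lineI:
  fixes x :: "'v::euclidean_space"
  assumes x: "x \<noteq> 0" and lim: "(\<lambda>i. c i *\<^sub>R xs i) \<longlonglongrightarrow> x"
  shows "limitin proj_topology (\<lambda>i. proj_line (xs i)) (proj_line x) sequentially"
proof -
  have "\<forall>\<^sub>F i in sequentially. proj_line (xs i) \<in> U"
    if U: "openin proj_topology U" "proj_line x \<in> U" for U
  proof -
    have "open {y. y \<noteq> 0 \<and> proj_line y \<in> U}" "x \<in> {y. y \<noteq> 0 \<and> proj_line y \<in> U}"
      using U x by (auto simp: openin_proj_topology)
    then have "\<forall>\<^sub>F i in sequentially. c i *\<^sub>R xs i \<in> {y. y \<noteq> 0 \<and> proj_line y \<in> U}"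
      using lim topological_tendstoD by blast
    then show ?thesis
      by eventually_elim (metis (mono_tags, lifting) mem_Collect_eq proj_line_scaleR scale_zero_left)
  qed
  then show ?thesis
    using x by (auto simp: limitin_def topspace_proj_topology)
qed

text \<open>The scalars come from the Euclidean inner product: the orthogonal projection of
  \<open>x\<close> onto the line of \<open>xs i\<close> depends only on that line, varies
  continuously with it and fixes \<open>x\<close>.\<close>

lemma limitin_proj_lineD:
  fixes x :: "'v::euclidean_space"
  assumes x: "x \<noteq> 0"
    and lim: "limitin proj_topology (\<lambda>i. proj_line (xs i)) (proj_line x) sequentially"
  obtains c where "(\<lambda>i. c i *\<^sub>R xs i) \<longlonglongrightarrow> x"
proof
  define P where "P y = ((x \<bullet> y) / (y \<bullet> y)) *\<^sub>R y" for y :: 'v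
  have P_scale: "P (k *\<^sub>R y) = P y" if "k \<noteq> 0" for k y
    using that by (simp add: P_def field_simps power2_eq_square)
  have P_line: "P y = P z" if "proj_line y = proj_line z" "y \<noteq> 0" "z \<noteq> 0" for y z
  proof -
    have "y \<in> span {z}"
      using that(1) mem_proj_line[of y] by (simp only: proj_line_def)
    then obtain k where "y = k *\<^sub>R z"
      by (auto simp: span_singleton)
    then show ?thesis using that P_scale by auto
  qed
  have cont: "continuous_on (UNIV - {0}) P"
    unfolding P_def by (intro continuous_intros) auto
  show "(\<lambda>i. ((x \<bullet> xs i) / (xs i \<bullet> xs i)) *\<^sub>R xs i) \<longlonglongrightarrow> x"
  proof (rule topological_tendstoI)
    fix A :: "'v set" assume A: "open A" "x \<in> A"
    define N where "N = {y \<in> UNIV - {0}. P y \<in> A}"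
    have "open N"
      using continuous_open_preimage[OF cont _ A(1)] by (simp add: open_delete N_def vimage_def Int_def)
    moreover have "{y. y \<noteq> 0 \<and> proj_line y \<in> proj_line ` N} = N"
    proof (intro equalityI subsetI)
      fix y assume "y \<in> {y. y \<noteq> 0 \<and> proj_line y \<in> proj_line ` N}"
      then obtain z where "y \<noteq> 0" "proj_line y = proj_line z" "z \<in> N" by auto
      then show "y \<in> N"
        using P_line[of y z] by (simp add: N_def)
    qed (auto simp: N_def)
    ultimately have "openin proj_topology (proj_line ` N)"
      by (auto simp: openin_proj_topology N_def)
    moreover have "P x = x"
      using x by (simp add: P_def)
    then have "proj_line x \<in> proj_line ` N"
      using x A by (auto simp: N_def)
    ultimately have "\<forall>\<^sub>F i in sequentially. proj_line (xs i) \<in> proj_line ` N"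
      using lim by (auto simp: limitin_def)
    then show "\<forall>\<^sub>F i in sequentially. ((x \<bullet> xs i) / (xs i \<bullet> xs i)) *\<^sub>R xs i \<in> A"
    proof eventually_elim
      case (elim i)
      then obtain y where y: "y \<in> N" "proj_line (xs i) = proj_line y" by auto
      have "xs i \<noteq> 0"
      proof
        assume "xs i = 0"
        then have "y \<in> span {0}"
          using y(2) mem_proj_line[of y] by (simp only: proj_line_def)
        then show False using y by (auto simp: N_def)
      qed
      then have "P (xs i) = P y"
        using y by (intro P_line) (auto simp: N_def)
      then show ?case using y by (simp add: N_def P_def)
    qed
  qed
qed

text \<open>Each term has a later one of larger norm, and iterating this choice makes the norms
  strictly increase. Supplies the injectivity that \<open>limit_directions\<close> demands.\<close>

lemma filterlim_at_infinity_inj_subseq: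
  fixes h :: "nat \<Rightarrow> 'a::real_normed_vector"
  assumes "filterlim h at_infinity sequentially"
  obtains r :: "nat \<Rightarrow> nat" where "strict_mono r" "inj (h \<circ> r)"
proof -
  have "\<exists>j>i. norm (h i) < norm (h j)" for i
  proof -
    have "\<forall>\<^sub>F j in sequentially. norm (h i) < norm (h j)"
      using assms by (simp add: filterlim_at_infinity_conv_norm_at_top filterlim_at_top_dense)
    then have "\<forall>\<^sub>F j in sequentially. norm (h i) < norm (h j) \<and> i < j"
      using eventually_gt_at_top eventually_conj by blast
    then show ?thesis
      by (metis (mono_tags, lifting) eventually_sequentially order_refl)
  qed
  then obtain g where g: "\<And>i. i < g i" "\<And>i. norm (h i) < norm (h (g i))"
    by metis
  define r where "r k = (g ^^ k) 0" for k
  have "strict_mono r" "strict_mono (\<lambda>k. norm (h (r k)))"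
    using g by (auto simp: strict_mono_Suc_iff r_def)
  moreover from this(2) have "inj (h \<circ> r)"
    unfolding inj_def by (metis comp_apply strict_mono_eq)
  ultimately show ?thesis using that by blast
qed

section \<open>Lorentzian forms\<close>

text \<open>The form is positive definite on the hyperplane orthogonal to the negative basis vector
  \<open>e\<close>. A nontrivial combination of \<open>x\<close> and \<open>y\<close> lies in it but
  has square at most 0, so it vanishes.\<close>

lemma lorentzian_orthogonal_isotropic:
  fixes b :: "'v::euclidean_space \<Rightarrow> 'v \<Rightarrow> real"
  assumes bil: "bilinear b" and sym: "\<And>x y. b x y = b y x"
    and sgn: "has_signature b (DIM('v) - 1) 1"
    and x: "b x x \<le> 0" "x \<noteq> 0" and y: "b y y \<le> 0" and xy: "b x y = 0"
  shows "y \<in> span {x}"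
proof -
  obtain E where E: "independent E" "span E = UNIV"
    and orth: "\<And>x y. x \<in> E \<Longrightarrow> y \<in> E \<Longrightarrow> x \<noteq> y \<Longrightarrow> b x y = 0"
    and pos: "card {x \<in> E. b x x > 0} = DIM('v) - 1" and neg: "card {x \<in> E. b x x < 0} = 1"
    using sgn unfolding has_signature_def by blast
  have fin: "finite E" using E(1) by (rule independent_imp_finite)
  have cardE: "card E = DIM('v)"
    using E by (metis dim_UNIV dim_eq_card_independent dim_span)
  obtain e where e: "{x \<in> E. b x x < 0} = {e}"
    using neg card_1_singletonE by blast
  have e': "e \<in> E" "b e e < 0" using e by auto
  \<comment> \<open>The \<open>DIM('v) - 1\<close> positive vectors and the negative one exhaust the
    basis, so none is isotropic.\<close>
  have "{x \<in> E. b x x > 0} = E - {e}"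
  proof (rule card_subset_eq)
    show "finite (E - {e})" using fin by simp
    show "{x \<in> E. b x x > 0} \<subseteq> E - {e}" using e' by auto
    show "card {x \<in> E. b x x > 0} = card (E - {e})" using pos cardE e' fin by simp
  qed
  then have pos': "b x x > 0" if "x \<in> E" "x \<noteq> e" for x using that by auto
  have lin: "linear (\<lambda>x. b x y)" for y using bil by (simp add: bilinear_def)
  have pd: "b z z > 0" if z: "b z e = 0" "z \<noteq> 0" for z
  proof -
    obtain k where k: "z = (\<Sum>v\<in>E. k v *\<^sub>R v)"
      using E(2) span_finite[OF fin] by (metis (no_types, lifting) UNIV_I imageE)
    have bz: "b z v = k v * b v v" if "v \<in> E" for v
    proof -
      have "b z v = (\<Sum>w\<in>E. k w * b w v)"
        by (simp add: k linear_sum[OF lin] linear_cmul[OF lin])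
      also have "\<dots> = (\<Sum>w\<in>E. if w = v then k v * b v v else 0)"
        using orth that by (intro sum.cong) auto
      finally show ?thesis using that fin by simp
    qed
    have "k e = 0" using bz[OF e'(1)] z e' by simp
    have "b z z = (\<Sum>w\<in>E. k w * b w z)"
      by (subst k) (simp add: linear_sum[OF lin] linear_cmul[OF lin])
    also have "\<dots> = (\<Sum>w\<in>E. (k w)\<^sup>2 * b w w)"
    proof (rule sum.cong)
      fix w assume "w \<in> E"
      then show "k w * b w z = (k w)\<^sup>2 * b w w"
        using bz[of w] sym[of w z] by (simp add: power2_eq_square)
    qed simp
    finally have bzz: "b z z = (\<Sum>w\<in>E. (k w)\<^sup>2 * b w w)" .
    obtain v where v: "v \<in> E" "k v \<noteq> 0"
      using k z(2) by (metis (no_types, lifting) scale_zero_left sum.neutral)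
    have nonneg: "(k w)\<^sup>2 * b w w \<ge> 0" if "w \<in> E" for w
      using pos'[OF that] \<open>k e = 0\<close> by (cases "w = e") (auto intro: mult_nonneg_nonneg)
    moreover have "(k v)\<^sup>2 * b v v > 0"
      using v pos' \<open>k e = 0\<close> by (metis zero_less_mult_iff zero_less_power2)
    ultimately show ?thesis
      unfolding bzz using fin v(1) by (intro sum_pos2[of E v]) auto
  qed
  have xe: "b x e \<noteq> 0" using pd[of x] x by fastforce
  define z where "z = b y e *\<^sub>R x - b x e *\<^sub>R y"
  have "b z e = 0"
    by (simp add: z_def bilinear_lsub[OF bil] bilinear_lmul[OF bil])
  moreover have "b z z = (b y e)\<^sup>2 * b x x + (b x e)\<^sup>2 * b y y"
    using xy sym[of y x] by (simp add: z_def bilinear_lsub[OF bil] bilinear_lmul[OF bil]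
      bilinear_rsub[OF bil] bilinear_rmul[OF bil] algebra_simps power2_eq_square)
  then have "b z z \<le> 0"
    using x y by (simp add: mult_nonneg_nonpos add_nonpos_nonpos)
  ultimately have "z = 0" using pd by fastforce
  then have "b x e *\<^sub>R y = b y e *\<^sub>R x" by (simp add: z_def)
  then have "inverse (b x e) *\<^sub>R (b x e *\<^sub>R y) = inverse (b x e) *\<^sub>R (b y e *\<^sub>R x)"
    by simp
  then have "y = (inverse (b x e) * b y e) *\<^sub>R x"
    using xe by simp
  then show ?thesis by (metis span_singleton rangeI)
qed

text \<open>Isolates what is used of the signature: orthogonal vectors of nonpositive square are
  proportional. The number \<open>b u x\<close> serves as a height that normalizes isotropic
  vectors.\<close>

locale lorentzian_form =
  fixes b :: "'v::euclidean_space \<Rightarrow> 'v \<Rightarrow> real" and u :: 'v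
  assumes bil: "bilinear b"
    and form_commute: "b x y = b y x"
    and timelike: "b u u = -1"
    and orthogonal_isotropic: "b x x \<le> 0 \<Longrightarrow> x \<noteq> 0 \<Longrightarrow> b y y \<le> 0 \<Longrightarrow> b x y = 0 \<Longrightarrow> y \<in> span {x}"
begin

lemmas form_simps = bilinear_ladd[OF bil] bilinear_radd[OF bil] bilinear_lsub[OF bil]
  bilinear_rsub[OF bil] bilinear_lmul[OF bil] bilinear_rmul[OF bil]
  bilinear_lneg[OF bil] bilinear_rneg[OF bil] bilinear_lzero[OF bil] bilinear_rzero[OF bil]

lemma tendsto_form:
  "(f \<longlongrightarrow> x) F \<Longrightarrow> (g \<longlongrightarrow> y) F \<Longrightarrow> ((\<lambda>i. b (f i) (g i)) \<longlongrightarrow> b x y) F"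
  using bil[unfolded bilinear_conv_bounded_bilinear] by (rule bounded_bilinear.tendsto)

lemma u_nonzero: "u \<noteq> 0"
  using timelike by (auto simp: form_simps)

lemma orthogonal_timelike_pos: "b u x = 0 \<Longrightarrow> x \<noteq> 0 \<Longrightarrow> b x x > 0"
proof (rule ccontr)
  assume *: "b u x = 0" "x \<noteq> 0" "\<not> b x x > 0"
  then have "x \<in> span {u}"
    using orthogonal_isotropic[of u x] timelike u_nonzero by auto
  then obtain k where "x = k *\<^sub>R u" by (auto simp: span_singleton)
  with * show False by (auto simp: form_simps timelike)
qed

lemma isotropic_unique:
  assumes "b x x = 0" "b y y = 0" "b x y = 0" "b u x = 1" "b u y = 1"
  shows "x = y"
proof -
  have "x \<noteq> 0" using assms by (auto simp: form_simps)
  then obtain k where "y = k *\<^sub>R x"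
    using orthogonal_isotropic[of x y] assms by (auto simp: span_singleton)
  then show ?thesis using assms by (simp add: form_simps)
qed

text \<open>Flipping the sign of \<open>b\<close> along \<open>u\<close> yields a positive definite form, which is comparable
  with the norm.\<close>
lemma norm_bound:
  obtains K where "K > 0" "\<And>x. (norm x)\<^sup>2 \<le> K * (b x x + 2 * (b u x)\<^sup>2)"
proof -
  define G where "G x = b x x + 2 * (b u x)\<^sup>2" for x
  have pos: "G x > 0" if "x \<noteq> 0" for x
  proof (cases "b u x = 0")
    case True
    then show ?thesis using orthogonal_timelike_pos that by (simp add: G_def)
  next
    case False
    \<comment> \<open>The component of \<open>x\<close> orthogonal to \<open>u\<close>; the sign is
      plus because \<open>b u u = -1\<close>.\<close>
    define y where "y = x + b u x *\<^sub>R u"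
    have "b u y = 0" by (simp add: y_def form_simps timelike)
    then have "b y y \<ge> 0"
      using orthogonal_timelike_pos[of y] by (cases "y = 0") (auto simp: form_simps)
    moreover have "b y y = b x x + (b u x)\<^sup>2"
      using form_commute[of x u]
      by (simp add: y_def form_simps timelike power2_eq_square algebra_simps)
    ultimately show ?thesis using False by (simp add: G_def)
       (smt (verit) zero_less_power2)
  qed
  have cont: "continuous_on UNIV G"
    unfolding G_def continuous_on_def by (intro ballI tendsto_intros tendsto_form)
  have "sphere (0::'v) 1 \<noteq> {}" by simp
  then obtain x0 where x0: "x0 \<in> sphere 0 1" "\<And>x. x \<in> sphere 0 1 \<Longrightarrow> G x0 \<le> G x"
    using continuous_attains_inf[OF compact_sphere _ continuous_on_subset[OF cont]] by (metis top_greatest)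
  have "x0 \<noteq> 0" using x0(1) by auto
  then have "G x0 > 0" by (rule pos)
  have "(norm x)\<^sup>2 \<le> (1 / G x0) * G x" for x
  proof (cases "x = 0")
    case True
    then show ?thesis by (simp add: G_def form_simps)
  next
    case False
    have "G x = (norm x)\<^sup>2 * G ((1 / norm x) *\<^sub>R x)"
      using False by (simp add: G_def form_simps field_simps power2_eq_square)
    moreover have "G x0 \<le> G ((1 / norm x) *\<^sub>R x)"
      using False by (intro x0) simp
    ultimately have "(norm x)\<^sup>2 * G x0 \<le> G x"
      by (simp add: mult_left_mono)
    then show ?thesis using \<open>G x0 > 0\<close> by (simp add: field_simps)
  qed
  then show ?thesis using that[of "1 / G x0"] \<open>G x0 > 0\<close> by (simp add: G_def)
qed

text \<open>Dividing by the height makes the squares tend to 0 and the heights eventually 1. By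
  \<open>norm_bound\<close> the quotients are then bounded, and compactness gives an isotropic
  limit.\<close>

lemma isotropic_limit_subseq:
  assumes inf: "filterlim (\<lambda>i. b u (x i)) at_infinity sequentially"
    and bounded: "\<And>i::nat. \<bar>b (x i) (x i)\<bar> \<le> M"
  obtains r z where "strict_mono r" "(\<lambda>i. x (r i) /\<^sub>R b u (x (r i))) \<longlonglongrightarrow> z" "b u z = 1" "b z z = 0"
proof -
  define y where "y i = x i /\<^sub>R b u (x i)" for i
  have inv0: "(\<lambda>i. inverse (b u (x i))) \<longlonglongrightarrow> 0"
    using filterlim_compose[OF tendsto_inverse_0 inf] .
  have ev: "\<forall>\<^sub>F i in sequentially. b u (y i) = 1"
    using filterlim_at_infinity_imp_eventually_ne[OF inf, of 0]
    by eventually_elim (simp add: y_def form_simps)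
  have "(\<lambda>i. (inverse (b u (x i)))\<^sup>2 * b (x i) (x i)) \<longlonglongrightarrow> 0"
  proof (rule Lim_null_comparison)
    show "\<forall>\<^sub>F i in sequentially. norm ((inverse (b u (x i)))\<^sup>2 * b (x i) (x i)) \<le> (inverse (b u (x i)))\<^sup>2 * M"
      using bounded by (auto simp: abs_mult intro!: mult_left_mono always_eventually)
    show "(\<lambda>i. (inverse (b u (x i)))\<^sup>2 * M) \<longlonglongrightarrow> 0"
      using tendsto_mult_right[OF tendsto_power[OF inv0, of 2], of M] by simp
  qed
  then have yy: "(\<lambda>i. b (y i) (y i)) \<longlonglongrightarrow> 0"
    by (simp add: y_def form_simps power2_eq_square mult.assoc)
  obtain K where K: "K > 0" "\<And>x. (norm x)\<^sup>2 \<le> K * (b x x + 2 * (b u x)\<^sup>2)"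
    by (rule norm_bound) blast
  have "\<forall>\<^sub>F i in sequentially. b (y i) (y i) < 1"
    using order_tendstoD(2)[OF yy, of 1] by simp
  with ev have "\<forall>\<^sub>F i in sequentially. norm (y i) \<le> sqrt (3 * K)"
  proof eventually_elim
    case (elim i)
    have "(norm (y i))\<^sup>2 \<le> K * (b (y i) (y i) + 2 * (b u (y i))\<^sup>2)" by (rule K)
    also have "\<dots> \<le> K * 3" using elim K by (intro mult_left_mono) auto
    finally show ?case using real_le_rsqrt by (simp add: mult.commute)
  qed
  then have "Bseq y" by (rule BfunI)
  then have "bounded (range y)" by (simp add: Bseq_eq_bounded)
  then obtain z r where r: "strict_mono r" and lim: "(y \<circ> r) \<longlonglongrightarrow> z"
    using bounded_imp_convergent_subsequence by blast
  have "(\<lambda>i. b u (y (r i))) \<longlonglongrightarrow> b u z"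
    using tendsto_form[OF tendsto_const lim] by (simp add: o_def)
  moreover have "(\<lambda>i. b u (y (r i))) \<longlonglongrightarrow> 1"
    using ev r by (intro tendsto_eventually) (rule eventually_subseq)
  ultimately have "b u z = 1" using LIMSEQ_unique by blast
  moreover have "b z z = 0"
    using LIMSEQ_unique[OF tendsto_form[OF lim lim]] LIMSEQ_subseq_LIMSEQ[OF yy r] by (simp add: o_def)
  ultimately show ?thesis using that r lim by (simp add: y_def o_def)
qed

lemma limit_directionsI:
  assumes "\<And>i::nat. x i \<in> X" and inf: "filterlim (\<lambda>i. b u (x i)) at_infinity sequentially"
    and lim: "(\<lambda>i. k i *\<^sub>R x i) \<longlonglongrightarrow> z" and z: "z \<noteq> 0"
  shows "proj_line z \<in> limit_directions X"
proof -
  obtain r :: "nat \<Rightarrow> nat" where r: "strict_mono r" "inj ((\<lambda>i. b u (x i)) \<circ> r)"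
    using inf by (rule filterlim_at_infinity_inj_subseq)
  have "inj (x \<circ> r)" using r(2) by (auto simp: inj_def)
  moreover have "(\<lambda>i. k (r i) *\<^sub>R (x \<circ> r) i) \<longlonglongrightarrow> z"
    using LIMSEQ_subseq_LIMSEQ[OF lim r(1)] by (simp add: o_def)
  then have "limitin proj_topology (\<lambda>i. proj_line ((x \<circ> r) i)) (proj_line z) sequentially"
    by (rule limitin_proj_lineI[OF z])
  ultimately show ?thesis
    using assms(1) z unfolding limit_directions_def by fastforce
qed

lemma proper_inj_at_infinity:
  fixes xs :: "nat \<Rightarrow> 'v"
  assumes proper: "\<And>M. finite {x \<in> X. \<bar>b u x\<bar> \<le> M}" and inj: "inj xs" and X: "range xs \<subseteq> X"
  shows "filterlim (\<lambda>i. b u (xs i)) at_infinity sequentially"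
  unfolding filterlim_at_infinity_conv_norm_at_top filterlim_at_top_dense
proof
  fix M
  have "finite (xs -` {x \<in> X. \<bar>b u x\<bar> \<le> M})"
    using finite_vimageI[OF proper inj] .
  moreover have "{i. \<not> M < norm (b u (xs i))} \<subseteq> xs -` {x \<in> X. \<bar>b u x\<bar> \<le> M}"
    using X by auto
  ultimately show "\<forall>\<^sub>F i in sequentially. M < norm (b u (xs i))"
    unfolding cofinite_eq_sequentially[symmetric] eventually_cofinite
    by (rule rev_finite_subset)
qed

text \<open>Replaces the unknown scalars of a projective limit by the inverse heights. In
  particular, every limit direction of a set with bounded squares and finitely many points below
  each height is isotropic.\<close>

lemma limit_directionsD:
  assumes L: "L \<in> limit_directions X"
    and proper: "\<And>M. finite {x \<in> X. \<bar>b u x\<bar> \<le> M}"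
    and bounded: "\<And>x. x \<in> X \<Longrightarrow> \<bar>b x x\<bar> \<le> M"
  obtains x z where "range (x :: nat \<Rightarrow> 'v) \<subseteq> X" "filterlim (\<lambda>i. b u (x i)) at_infinity sequentially"
    "(\<lambda>i. x i /\<^sub>R b u (x i)) \<longlonglongrightarrow> z" "b u z = 1" "b z z = 0" "L = proj_line z"
proof -
  obtain xs y where y: "y \<noteq> 0" "L = proj_line y" and inj: "inj xs" and X: "range xs \<subseteq> X"
    and lim: "limitin proj_topology (\<lambda>i. proj_line (xs i)) (proj_line y) sequentially"
    using L unfolding limit_directions_def by blast
  obtain c where c: "(\<lambda>i. c i *\<^sub>R xs i) \<longlonglongrightarrow> y"
    using limitin_proj_lineD[OF y(1) lim] by blast
  have inf: "filterlim (\<lambda>i. b u (xs i)) at_infinity sequentially"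
    using proper inj X by (rule proper_inj_at_infinity)
  have bounded': "\<bar>b (xs i) (xs i)\<bar> \<le> M" for i
    using bounded X by auto
  obtain r z where r: "strict_mono r" and z: "(\<lambda>i. xs (r i) /\<^sub>R b u (xs (r i))) \<longlonglongrightarrow> z"
      "b u z = 1" "b z z = 0"
    by (rule isotropic_limit_subseq[OF inf bounded'])
  have inf_r: "filterlim (\<lambda>i. b u (xs (r i))) at_infinity sequentially"
    using filterlim_compose[OF inf filterlim_subseq[OF r]] .
  have "(\<lambda>i. c (r i) *\<^sub>R xs (r i)) \<longlonglongrightarrow> y"
    using LIMSEQ_subseq_LIMSEQ[OF c r] by (simp add: o_def)
  then have cb: "(\<lambda>i. c (r i) * b u (xs (r i))) \<longlonglongrightarrow> b u y"
    using tendsto_form[OF tendsto_const[of u]] by (fastforce simp: form_simps)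
  \<comment> \<open>Both factors converge, so the original limit \<open>y\<close> is a multiple of
    \<open>z\<close>.\<close>
  have "(\<lambda>i. (c (r i) * b u (xs (r i))) *\<^sub>R (xs (r i) /\<^sub>R b u (xs (r i)))) \<longlonglongrightarrow> b u y *\<^sub>R z"
    using cb z(1) by (rule tendsto_scaleR)
  moreover have "\<forall>\<^sub>F i in sequentially. (c (r i) * b u (xs (r i))) *\<^sub>R (xs (r i) /\<^sub>R b u (xs (r i)))
      = c (r i) *\<^sub>R xs (r i)"
    using filterlim_at_infinity_imp_eventually_ne[OF inf_r, of 0] by eventually_elim simp
  ultimately have "(\<lambda>i. c (r i) *\<^sub>R xs (r i)) \<longlonglongrightarrow> b u y *\<^sub>R z"
    by (rule Lim_transform_eventually)
  then have yz: "y = b u y *\<^sub>R z"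
    using \<open>(\<lambda>i. c (r i) *\<^sub>R xs (r i)) \<longlonglongrightarrow> y\<close> LIMSEQ_unique by blast
  then have "b u y \<noteq> 0" using y(1) by auto
  then have "proj_line y = proj_line z"
    by (metis yz proj_line_scaleR)
  then show ?thesis using that[of "xs \<circ> r" z] X z inf_r y by (auto simp: o_def)
qed

end

section \<open>Positivity of roots\<close>

text \<open>The word grows at its left end, so a nonempty one ends in \<open>t\<close>. This suits
  the action on \<open>\<alpha> s\<close>, where a final \<open>s\<close> would only flip the
  sign.\<close>

primrec alternating_word :: "'a \<Rightarrow> 'a \<Rightarrow> nat \<Rightarrow> 'a list" where
  "alternating_word s t 0 = []"
| "alternating_word s t (Suc k) = (if even k then t else s) # alternating_word s t k"

lemma length_alternating_word [simp]: "length (alternating_word s t k) = k"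
  by (induction k) auto

lemma set_alternating_word: "set (alternating_word s t k) \<subseteq> {s, t}"
  by (induction k) auto

lemma alternating_word_double: "alternating_word s t (2 * k) = concat (replicate k [s, t])"
  by (induction k) auto

lemma alternating_word_suffix:
  "j \<le> k \<Longrightarrow> \<exists>us. set us \<subseteq> {s, t} \<and> length us = k - j \<and> alternating_word s t k = us @ alternating_word s t j"
proof (induction k rule: dec_induct)
  case base
  then show ?case by simp
next
  case (step k)
  then obtain us where "set us \<subseteq> {s, t}" "length us = k - j"
    "alternating_word s t k = us @ alternating_word s t j" by blast
  then show ?case
    using step(1) by (intro exI[of _ "(if even k then t else s) # us"]) auto
qed

lemma alternating_wordI:
  assumes "set us \<subseteq> {s, t}" "\<And>pre y post. us \<noteq> pre @ [y, y] @ post" "\<And>pre. us \<noteq> pre @ [s]"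
  shows "us = alternating_word s t (length us)"
  using assms
proof (induction us)
  case (Cons x us)
  have IH: "us = alternating_word s t (length us)"
  proof (rule Cons.IH)
    show "us \<noteq> pre @ [y, y] @ post" for pre y post
      using Cons.prems(2)[of "x # pre" y post] by simp
    show "us \<noteq> pre @ [s]" for pre
      using Cons.prems(3)[of "x # pre"] by simp
  qed (use Cons.prems in auto)
  show ?case
  proof (cases "length us")
    case 0
    then show ?thesis using Cons.prems(1) Cons.prems(3)[of "[]"] by auto
  next
    case (Suc j)
    then have us: "us = (if even j then t else s) # alternating_word s t j"
      using IH by simp
    have "x \<noteq> (if even j then t else s)"
      using Cons.prems(2)[of "[]" x "alternating_word s t j"] us by auto
    then have "x = (if even (Suc j) then t else s)"
      using Cons.prems(1) by auto
    then show ?thesis using IH Suc by simp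
  qed
qed simp

text \<open>The coefficients of the roots of a dihedral subsystem: shifted Chebyshev polynomials of the
  second kind, \<open>U\<^bsub>k-1\<^esub>(c)\<close>.\<close>
fun dihedral_coeff :: "real \<Rightarrow> nat \<Rightarrow> real" where
  "dihedral_coeff c 0 = 0"
| "dihedral_coeff c (Suc 0) = 1"
| "dihedral_coeff c (Suc (Suc k)) = 2 * c * dihedral_coeff c (Suc k) - dihedral_coeff c k"

lemma dihedral_coeff_cos:
  assumes "sin \<theta> \<noteq> 0"
  shows "dihedral_coeff (cos \<theta>) k = sin (real k * \<theta>) / sin \<theta>"
proof (induction "cos \<theta>" k rule: dihedral_coeff.induct)
  case (3 k)
  have "sin (real (Suc (Suc k)) * \<theta>) = sin (real (Suc k) * \<theta> + \<theta>)"
    by (simp add: algebra_simps)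
  also have "\<dots> = 2 * cos \<theta> * sin (real (Suc k) * \<theta>) - sin (real (Suc k) * \<theta> - \<theta>)"
    by (simp only: sin_add sin_diff) algebra
  also have "real (Suc k) * \<theta> - \<theta> = real k * \<theta>"
    by (simp add: algebra_simps)
  finally show ?case
    using 3 assms by (simp add: field_simps)
qed (use assms in auto)

text \<open>The set of 0 and all numbers from 1 on is closed under sums and products, so the gap
  survives induction on words. Plain nonnegativity would not give discreteness of orbits.\<close>

abbreviation zero_or_ge_1 :: "real \<Rightarrow> bool" where
  "zero_or_ge_1 x \<equiv> x = 0 \<or> 1 \<le> x"

lemma zero_or_ge_1_add: "zero_or_ge_1 x \<Longrightarrow> zero_or_ge_1 y \<Longrightarrow> zero_or_ge_1 (x + y)"
  by auto

lemma zero_or_ge_1_mult: "zero_or_ge_1 x \<Longrightarrow> zero_or_ge_1 y \<Longrightarrow> zero_or_ge_1 (x * y)"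
  using mult_mono[of 1 x 1 y] by auto

text \<open>With \<open>\<theta> = pi / n\<close> the coefficient is
  \<open>sin (k * \<theta>) / sin \<theta>\<close>. For \<open>0 < k < n\<close> the angle lies
  between \<theta> and pi - \<theta>, where the sine is at least \<open>sin \<theta>\<close>; for
  \<open>k = n\<close> it is 0.\<close>

lemma dihedral_coeff_cos_gap:
  assumes n: "2 \<le> n" and k: "k \<le> n"
  shows "zero_or_ge_1 (dihedral_coeff (cos (pi / real n)) k)"
proof -
  define \<theta> where "\<theta> = pi / real n"
  have \<theta>: "0 < \<theta>" "\<theta> \<le> pi / 2"
    unfolding \<theta>_def using n by (simp, intro divide_left_mono) auto
  then have sin_pos: "sin \<theta> > 0"
    by (intro sin_gt_zero) (auto intro: le_less_trans)
  have coeff: "dihedral_coeff (cos \<theta>) k = sin (real k * \<theta>) / sin \<theta>"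
    using sin_pos by (intro dihedral_coeff_cos) simp
  have n\<theta>: "real n * \<theta> = pi" using n by (simp add: \<theta>_def)
  consider "k = 0" | "k = n" | "1 \<le> k" "k + 1 \<le> n" using k by linarith
  then have "zero_or_ge_1 (sin (real k * \<theta>) / sin \<theta>)"
  proof cases
    case 3
    have lo: "\<theta> \<le> real k * \<theta>"
      using 3 \<theta> mult_right_mono[of 1 "real k" \<theta>] by simp
    have "real (k + 1) * \<theta> \<le> real n * \<theta>"
      using 3 \<theta> by (intro mult_right_mono) auto
    then have hi: "\<theta> \<le> pi - real k * \<theta>"
      using n\<theta> by (simp add: algebra_simps)
    have "sin \<theta> \<le> sin (real k * \<theta>)"
    proof (cases "real k * \<theta> \<le> pi / 2")
      case True
      then show ?thesis using lo \<theta> by (intro sin_monotone_2pi_le) auto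
    next
      case False
      then have "sin \<theta> \<le> sin (pi - real k * \<theta>)"
        using hi \<theta> by (intro sin_monotone_2pi_le) auto
      then show ?thesis by simp
    qed
    then show ?thesis using sin_pos by simp
  qed (use n\<theta> in auto)
  then show ?thesis using coeff by (simp add: \<theta>_def)
qed

text \<open>As \<open>2 * c\<close> is at least 2, the recursion never lets the increments shrink,
  and the first one is 1.\<close>

lemma dihedral_coeff_hyperbolic_gap:
  assumes "1 \<le> c"
  shows "zero_or_ge_1 (dihedral_coeff c k)"
proof -
  have *: "0 \<le> dihedral_coeff c j \<and> dihedral_coeff c j + 1 \<le> dihedral_coeff c (Suc j)" for j
  proof (induction j)
    case (Suc j)
    have "1 * dihedral_coeff c (Suc j) \<le> c * dihedral_coeff c (Suc j)"
      using assms Suc by (intro mult_right_mono) auto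
    then show ?case using Suc
      by (simp only: dihedral_coeff.simps mult.assoc) linarith
  qed simp
  show ?thesis using *[of "k - 1"] by (cases k) auto
qed

section \<open>Words in the simple reflections, their length, and Tits' theorem\<close>

context geometric_coxeter_system
begin

lemmas b_simps = bilinear_ladd[OF form_bilinear] bilinear_radd[OF form_bilinear]
  bilinear_lsub[OF form_bilinear] bilinear_rsub[OF form_bilinear]
  bilinear_lmul[OF form_bilinear] bilinear_rmul[OF form_bilinear]
  bilinear_lneg[OF form_bilinear] bilinear_rneg[OF form_bilinear]
  bilinear_lzero[OF form_bilinear] bilinear_rzero[OF form_bilinear]

lemma b_sum_right: "b x (\<Sum>s\<in>A. k s *\<^sub>R f s) = (\<Sum>s\<in>A. k s * b x (f s))"
proof -
  have "linear (b x)" using form_bilinear by (simp add: bilinear_def)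
  then show ?thesis by (simp add: linear_sum linear_cmul)
qed

lemma simple_norm: "s \<in> S \<Longrightarrow> b (\<alpha> s) (\<alpha> s) = 1"
  by (simp add: form_simple coxeter_entry_def m_diag one_enat_def)

lemma reflection_eq: "s \<in> S \<Longrightarrow> form_reflection b (\<alpha> s) x = x - (2 * b x (\<alpha> s)) *\<^sub>R \<alpha> s"
  by (simp add: form_reflection_def simple_norm)

lemma reflection_involution:
  "s \<in> S \<Longrightarrow> form_reflection b (\<alpha> s) (form_reflection b (\<alpha> s) x) = x"
  by (simp add: reflection_eq b_simps simple_norm algebra_simps flip: scaleR_add_left)

lemma reflection_isometry:
  "s \<in> S \<Longrightarrow> b (form_reflection b (\<alpha> s) x) (form_reflection b (\<alpha> s) y) = b x y"
  using form_sym[of "\<alpha> s" y]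
  by (simp add: reflection_eq b_simps simple_norm algebra_simps)

definition act :: "'w list \<Rightarrow> 'v \<Rightarrow> 'v" where
  "act us x = foldr (\<lambda>s. form_reflection b (\<alpha> s)) us x"

lemma act_Nil [simp]: "act [] x = x"
  and act_Cons [simp]: "act (s # us) x = form_reflection b (\<alpha> s) (act us x)"
  and act_append [simp]: "act (us @ vs) x = act us (act vs x)"
  by (simp_all add: act_def)

lemma linear_act: "linear (act us)"
proof (induction us)
  case Nil
  then show ?case using linear_id by (simp add: id_def act_def)
next
  case (Cons s us)
  have "linear (form_reflection b (\<alpha> s))"
    by (rule linearI) (simp_all add: form_reflection_def b_simps algebra_simps add_divide_distrib)
  from linear_compose[OF Cons this] show ?case by (simp add: o_def fun_eq_iff act_def)
qed

lemma act_isometry: "us \<in> lists S \<Longrightarrow> b (act us x) (act us y) = b x y"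
  by (induction us) (auto simp: reflection_isometry)

lemma act_rev_cancel: "us \<in> lists S \<Longrightarrow> act (rev us) (act us x) = x"
  by (induction us arbitrary: x) (auto simp: reflection_involution)

lemma act_cancel_rev: "us \<in> lists S \<Longrightarrow> act us (act (rev us) x) = x"
  using act_rev_cancel[of "rev us"] by (auto simp: in_lists_conv_set)

lemma act_adjoint: "us \<in> lists S \<Longrightarrow> b (act us x) y = b x (act (rev us) y)"
  by (metis act_cancel_rev act_isometry)

lemma act_word_value:
  assumes "us \<in> lists S"
  shows "word_value W us \<in> carrier W \<and> \<rho> (word_value W us) = act us"
  using assms
proof (induction us)
  case Nil
  have "\<rho> \<one> x = x" for x using fun_cong[OF id_eq_one, of x] by simp
  then show ?case by (simp add: word_value_def fun_eq_iff)
next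
  case (Cons s us)
  then have s: "s \<in> S" "s \<in> carrier W" using S_subset by auto
  have "\<rho> (s \<otimes> word_value W us) x = \<rho> s (\<rho> (word_value W us) x)" for x
    using Cons s by (intro composition_rule) auto
  then show ?case
    using Cons s action_simple by (simp add: word_value_def fun_eq_iff)
qed

lemma action_eq_act: "\<rho> ` carrier W = act ` lists S"
proof
  show "act ` lists S \<subseteq> \<rho> ` carrier W"
    using act_word_value by (metis image_eqI image_subsetI)
  have "\<rho> w \<in> act ` lists S \<and> w \<in> carrier W" if "w \<in> generate W S" for w
    using that
  proof induction
    case one
    have "\<rho> \<one> = act []" using act_word_value[of "[]"] by (simp add: word_value_def)
    then have "\<rho> \<one> \<in> act ` lists S" by (metis lists.Nil imageI)
    then show ?case by simp
  next
    case (incl s)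
    then have "act [s] = \<rho> s" using action_simple by (simp add: fun_eq_iff)
    then show ?case using incl S_subset by (metis Cons_in_lists_iff lists.Nil image_eqI subsetD)
  next
    case (inv s)
    then have s: "s \<in> carrier W" using S_subset by auto
    have one: "\<rho> \<one> x = x" for x using fun_cong[OF id_eq_one, of x] by simp
    have "\<rho> (inv s) x = act [s] x" for x
    proof -
      have "\<rho> (inv s) (\<rho> s (act [s] x)) = \<rho> (inv s \<otimes> s) (act [s] x)"
        using s by (intro composition_rule[symmetric]) auto
      then show ?thesis
        using inv s one by (simp add: action_simple reflection_involution)
    qed
    then have "\<rho> (inv s) = act [s]" by blast
    then show ?case using inv s by (metis Cons_in_lists_iff lists.Nil image_eqI inv_closed)
  next
    case (eng g h)
    then obtain us vs where "us \<in> lists S" "vs \<in> lists S" "\<rho> g = act us" "\<rho> h = act vs" by auto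
    moreover from this eng have "\<rho> (g \<otimes> h) = act (us @ vs)"
      by (auto simp: fun_eq_iff composition_rule)
    ultimately show ?case using eng by (metis append_in_lists_conv image_eqI m_closed)
  qed
  then show "\<rho> ` carrier W \<subseteq> act ` lists S" using generated by auto
qed

lemma orbit_set_eq: "orbit_set W \<rho> X = {act us x | us x. us \<in> lists S \<and> x \<in> X}"
proof -
  have "orbit_set W \<rho> X = (\<Union>f\<in>\<rho> ` carrier W. f ` X)"
    by (simp add: orbit_set_def)
  then show ?thesis unfolding action_eq_act by auto
qed

lemma act_relation:
  assumes "s \<in> S" "t \<in> S" "m s t = enat k"
  shows "act (alternating_word s t (2 * k)) x = x"
proof -
  let ?us = "concat (replicate k [s, t])"
  have us: "?us \<in> lists S"
    using set_alternating_word[of s t "2 * k"] assms(1,2)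
    unfolding alternating_word_double by blast
  have "coxeter_cong S m ([] @ ?us @ []) ([] @ [])"
    using assms by (rule coxeter_cong.relator)
  then have "word_value W ?us = word_value W []"
    using presentation[of ?us "[]"] us by simp
  then have "act ?us = act []"
    using act_word_value us by (metis lists.Nil)
  then show ?thesis by (simp add: alternating_word_double)
qed

text \<open>Moves \<open>j\<close> letters of the relator to the other side, one reflection at a
  time. The case \<open>j = k\<close> is the braid relation.\<close>

lemma act_alternating_swap:
  assumes st: "s \<in> S" "t \<in> S" "m s t = enat k" and "j \<le> 2 * k"
  shows "act (alternating_word s t (2 * k - j)) x = act (alternating_word t s j) x"
  using assms(4)
proof (induction j arbitrary: x)
  case 0
  then show ?case using act_relation[OF st] by simp
next
  case (Suc j)
  define i where "i = 2 * k - Suc j"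
  have i: "2 * k - j = Suc i" using Suc.prems by (simp add: i_def)
  have "even i \<longleftrightarrow> odd j" using Suc.prems by (auto simp: i_def)
  then have "form_reflection b (\<alpha> (if even j then s else t)) (act (alternating_word s t (Suc i)) x)
      = act (alternating_word s t i) x"
    using st by (auto simp: reflection_involution)
  then show ?case using Suc unfolding i by (simp add: i_def)
qed

text \<open>Prefixing a reflection changes only the coefficient of its own root, by one step of the
  recursion; the parity of \<open>k\<close> tells which of the two was updated last.\<close>

lemma act_alternating_simple:
  assumes "s \<in> S" "t \<in> S"
  defines "\<kappa> \<equiv> - b (\<alpha> s) (\<alpha> t)"
  shows "act (alternating_word s t k) (\<alpha> s) =
    dihedral_coeff \<kappa> (if even k then Suc k else k) *\<^sub>R \<alpha> s +
    dihedral_coeff \<kappa> (if even k then k else Suc k) *\<^sub>R \<alpha> t"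
proof (induction k)
  case (Suc k)
  show ?case
    using assms Suc form_sym[of "\<alpha> t" "\<alpha> s"]
    by (auto simp: reflection_eq b_simps simple_norm algebra_simps simp flip: scaleR_add_left)
qed simp

text \<open>The length belongs to the linear map rather than to the group element, so that words
  with the same action can be exchanged freely.\<close>

definition len :: "('v \<Rightarrow> 'v) \<Rightarrow> nat" where
  "len f = (LEAST n. \<exists>us\<in>lists S. length us = n \<and> act us = f)"

lemma len_le: "us \<in> lists S \<Longrightarrow> len (act us) \<le> length us"
  unfolding len_def by (rule Least_le) auto

lemma reduced_word:
  assumes "us \<in> lists S"
  obtains rs where "rs \<in> lists S" "length rs = len (act us)" "act rs = act us"
proof -
  have "\<exists>rs\<in>lists S. length rs = len (act us) \<and> act rs = act us"
    unfolding len_def by (rule LeastI_ex) (use assms in auto)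
  then show ?thesis using that by blast
qed

lemma len_append_le:
  assumes "us \<in> lists S" "vs \<in> lists S"
  shows "len (act (us @ vs)) \<le> len (act us) + length vs"
proof -
  obtain rs where rs: "rs \<in> lists S" "length rs = len (act us)" "act rs = act us"
    using assms(1) by (rule reduced_word)
  then have "act (us @ vs) = act (rs @ vs)" by (simp add: fun_eq_iff)
  then show ?thesis using len_le[of "rs @ vs"] rs assms by simp
qed

lemma len_rev:
  assumes "us \<in> lists S"
  shows "len (act (rev us)) = len (act us)"
proof -
  have "len (act (rev us)) \<le> len (act us)" if us: "us \<in> lists S" for us
  proof -
    obtain rs where rs: "rs \<in> lists S" "length rs = len (act us)" "act rs = act us"
      using us by (rule reduced_word)
    have "act (rev us) x = act (rev rs) x" for x
      using act_rev_cancel[OF rs(1), of "act (rev us) x"] act_cancel_rev[OF us] rs(3) by simp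
    then have "act (rev us) = act (rev rs)" by blast
    then show ?thesis using len_le[of "rev rs"] rs by (auto simp: in_lists_conv_set)
  qed
  from this[OF assms] this[of "rev us"] assms show ?thesis
    by (auto simp: in_lists_conv_set)
qed

text \<open>Despite its name, this set allows scaling only by 0 or by factors from 1 on. This keeps
  nonzero pairings with dominant vectors away from 0.\<close>

definition gap_cone :: "'v set" where
  "gap_cone = {\<Sum>s\<in>S. k s *\<^sub>R \<alpha> s | k. \<forall>s\<in>S. zero_or_ge_1 (k s)}"

lemma simple_in_gap_cone:
  assumes "s \<in> S"
  shows "\<alpha> s \<in> gap_cone"
proof -
  have "\<alpha> s = (\<Sum>t\<in>S. (if t = s then 1 else 0) *\<^sub>R \<alpha> t)"
    using assms finite_S by (simp add: if_distrib[of "\<lambda>k. k *\<^sub>R _"] cong: if_cong)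
  then show ?thesis unfolding gap_cone_def
    by (intro CollectI exI[of _ "\<lambda>t. if t = s then 1 else 0"]) auto
qed

lemma gap_cone_combination:
  assumes "x \<in> gap_cone" "y \<in> gap_cone" "zero_or_ge_1 p" "zero_or_ge_1 q"
  shows "p *\<^sub>R x + q *\<^sub>R y \<in> gap_cone"
proof -
  obtain k l where k: "x = (\<Sum>s\<in>S. k s *\<^sub>R \<alpha> s)" "\<And>s. s \<in> S \<Longrightarrow> zero_or_ge_1 (k s)"
    and l: "y = (\<Sum>s\<in>S. l s *\<^sub>R \<alpha> s)" "\<And>s. s \<in> S \<Longrightarrow> zero_or_ge_1 (l s)"
    using assms unfolding gap_cone_def by blast
  have "p *\<^sub>R x + q *\<^sub>R y = (\<Sum>s\<in>S. (p * k s + q * l s) *\<^sub>R \<alpha> s)"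
    by (simp add: k l scaleR_sum_right sum.distrib scaleR_add_left)
  moreover have "zero_or_ge_1 (p * k s + q * l s)" if "s \<in> S" for s
    using that assms k l by (intro zero_or_ge_1_add zero_or_ge_1_mult)
  ultimately show ?thesis
    unfolding gap_cone_def by (intro CollectI exI[of _ "\<lambda>s. p * k s + q * l s"]) auto
qed

text \<open>The rank two case of Tits' theorem. Minimality and \<open>ascent\<close> force
  \<open>us\<close> to be the alternating word ending in \<open>t\<close>, of length less than
  \<open>m s t\<close>; there both coefficients have the gap.\<close>

lemma dihedral_root:
  assumes st: "s \<in> S" "t \<in> S" "s \<noteq> t" and us: "us \<in> lists {s, t}"
    and reduced: "\<And>vs. vs \<in> lists {s, t} \<Longrightarrow> act vs = act us \<Longrightarrow> length us \<le> length vs"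
    and ascent: "\<And>vs. vs \<in> lists {s, t} \<Longrightarrow> act vs = act (us @ [s]) \<Longrightarrow> length us \<le> length vs"
  obtains p q where "zero_or_ge_1 p" "zero_or_ge_1 q" "act us (\<alpha> s) = p *\<^sub>R \<alpha> s + q *\<^sub>R \<alpha> t"
proof -
  define k where "k = length us"
  have set_us: "set us \<subseteq> {s, t}" using us by auto
  have us_eq: "us = alternating_word s t k"
    unfolding k_def
  proof (rule alternating_wordI[OF set_us])
    show "us \<noteq> pre @ [y, y] @ post" for pre y post
    proof
      assume *: "us = pre @ [y, y] @ post"
      then have "act (pre @ post) = act us"
        using st us by (auto simp: fun_eq_iff reflection_involution)
      then show False using reduced[of "pre @ post"] us * by auto
    qed
    show "us \<noteq> pre @ [s]" for pre
    proof
      assume *: "us = pre @ [s]"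
      then have "act pre = act (us @ [s])"
        using st by (auto simp: fun_eq_iff reflection_involution)
      then show False using ascent[of pre] us * by auto
    qed
  qed
  define \<kappa> where "\<kappa> = - b (\<alpha> s) (\<alpha> t)"
  have gap: "zero_or_ge_1 (dihedral_coeff \<kappa> j)" if j: "j \<le> Suc k" for j
  proof (cases "m s t")
    case infinity
    then have "1 \<le> \<kappa>"
      using st c_ge_1[of s t] by (simp add: \<kappa>_def form_simple coxeter_entry_def)
    then show ?thesis by (rule dihedral_coeff_hyperbolic_gap)
  next
    case (enat n)
    have "2 \<le> n" using m_ge_2[OF st] enat by (simp add: numeral_eq_enat)
    \<comment> \<open>Otherwise the braid relation turns the last \<open>n\<close> letters into a
      word ending in \<open>s\<close>; appending \<open>s\<close> cancels and leaves
      \<open>k - 1\<close> letters, against \<open>ascent\<close>.\<close>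
    have "k < n"
    proof (rule ccontr)
      assume "\<not> k < n"
      then have "n \<le> k" by simp
      from alternating_word_suffix[OF this, of s t] obtain pre where pre: "set pre \<subseteq> {s, t}"
        "length pre = k - n" "us = pre @ alternating_word s t n" using us_eq by auto
      obtain n' where n': "n = Suc n'" using \<open>2 \<le> n\<close> by (cases n) auto
      have swap: "act (alternating_word s t n) x = act (alternating_word t s n) x" for x
        using act_alternating_swap[OF st(1,2) enat, of n x] by (simp add: mult_2)
      have rev: "\<exists>ws. set ws \<subseteq> {s, t} \<and> length ws = n' \<and> alternating_word t s n = ws @ [s]"
        using alternating_word_suffix[of 1 n t s] n' by auto
      then obtain ws where ws: "set ws \<subseteq> {s, t}" "length ws = n'" "alternating_word t s n = ws @ [s]"
        by blast
      have "act (pre @ ws) x = act (us @ [s]) x" for x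
        using st by (simp add: pre(3) swap ws(3) reflection_involution)
      then have "act (pre @ ws) = act (us @ [s])" by blast
      then have "k \<le> length (pre @ ws)"
        unfolding k_def using pre ws by (intro ascent) auto
      then show False using pre ws \<open>n \<le> k\<close> n' by simp
    qed
    then have "zero_or_ge_1 (dihedral_coeff (cos (pi / real n)) j)"
      using j \<open>2 \<le> n\<close> by (intro dihedral_coeff_cos_gap) auto
    then show ?thesis
      using st enat by (simp add: \<kappa>_def form_simple coxeter_entry_def)
  qed
  show ?thesis
    by (rule that[OF gap gap act_alternating_simple[OF st(1,2), of k, folded us_eq \<kappa>_def]]) auto
qed

text \<open>Tits' theorem that elements send simple roots to positive or negative roots, in a version
  that also bounds the nonzero coefficients away from zero.\<close>
theorem root_in_gap_cone:
  assumes "us \<in> lists S" "s \<in> S" "len (act us) \<le> len (act (us @ [s]))"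
  shows "act us (\<alpha> s) \<in> gap_cone"
  using assms
proof (induction "len (act us)" arbitrary: us s rule: less_induct)
  case less
  obtain rs where rs: "rs \<in> lists S" "length rs = len (act us)" "act rs = act us"
    using less.prems(1) by (rule reduced_word)
  show ?case
  proof (cases rs rule: rev_cases)
    case Nil
    then show ?thesis using rs(3) less.prems simple_in_gap_cone by (metis act_Nil)
  next
    case (snoc gs t)
    have gs: "gs \<in> lists S" "t \<in> S" using rs snoc by auto
    have len_gs: "len (act gs) < len (act us)"
      using len_le[OF gs(1)] rs snoc by simp
    have "s \<noteq> t"
    proof
      assume "s = t"
      have "act (us @ [s]) x = act gs x" for x
        using gs rs(3)[symmetric] snoc \<open>s = t\<close> by (simp add: reflection_involution)
      then have "act (us @ [s]) = act gs" by blast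
      then show False using less.prems(3) len_gs by simp
    qed
    \<comment> \<open>Factor \<open>us\<close>, without gaining length, into \<open>v\<close> and a
      word in \<open>s\<close> and \<open>t\<close>. With \<open>v\<close> as short as possible, it
      is a minimal representative of its coset of the dihedral subgroup; the factorization
      \<open>(gs, [t])\<close> ensures that \<open>v\<close> is shorter than
      \<open>us\<close>.\<close>
    define P where "P = (\<lambda>(v, ws). v \<in> lists S \<and> ws \<in> lists {s, t} \<and> act (v @ ws) = act us
      \<and> len (act v) + length ws \<le> len (act us))"
    have "P (gs, [t])"
      using gs len_gs rs snoc by (simp add: P_def)
    from ex_has_least_nat[of P, OF this, of "\<lambda>(v, ws). len (act v)"]
    obtain v ws where Pv: "P (v, ws)"
      and least: "\<And>v' ws'. P (v', ws') \<Longrightarrow> len (act v) \<le> len (act v')" by auto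
    have v: "v \<in> lists S" "ws \<in> lists {s, t}" and vws: "act (v @ ws) = act us"
      and len_v: "len (act v) + length ws \<le> len (act us)" using Pv by (auto simp: P_def)
    have ws: "ws \<in> lists S" using v(2) less.prems(2) gs by auto
    have *: "act v (\<alpha> x) \<in> gap_cone" if x: "x \<in> {s, t}" for x
    proof (rule less.hyps)
      have "x \<in> S" using x less.prems gs by auto
      show "len (act v) < len (act us)" using least[OF \<open>P (gs, [t])\<close>] len_gs by simp
      show "len (act v) \<le> len (act (v @ [x]))"
      proof (rule ccontr)
        assume less_len: "\<not> len (act v) \<le> len (act (v @ [x]))"
        \<comment> \<open>If \<open>x\<close> shortened \<open>v\<close>, the letter could be moved
          over to \<open>ws\<close>, against the choice of \<open>v\<close>.\<close>
        have "act ((v @ [x]) @ x # ws) = act us"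
          using \<open>x \<in> S\<close> by (simp add: fun_eq_iff reflection_involution vws[symmetric])
        then have "P (v @ [x], x # ws)"
          using less_len v x \<open>x \<in> S\<close> len_v by (simp add: P_def)
        then show False using least less_len by blast
      qed
    qed (use v x less.prems gs in auto)
    obtain p q where pq: "zero_or_ge_1 p" "zero_or_ge_1 q" "act ws (\<alpha> s) = p *\<^sub>R \<alpha> s + q *\<^sub>R \<alpha> t"
    proof (rule dihedral_root[OF less.prems(2) gs(2) \<open>s \<noteq> t\<close> v(2)])
      \<comment> \<open>A shorter word for \<open>ws\<close>, or for \<open>ws\<close> followed by
        \<open>s\<close>, would bring \<open>us\<close>, or \<open>us\<close> followed by
        \<open>s\<close>, below the length of \<open>us\<close>.\<close>
      fix vs assume vs: "vs \<in> lists {s, t}"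
      then have vs': "vs \<in> lists S" using less.prems(2) gs by auto
      {
        assume "act vs = act ws"
        then have "act (v @ vs) = act us" by (simp add: fun_eq_iff vws[symmetric])
        then show "length ws \<le> length vs"
          using len_append_le[OF v(1) vs'] len_v by simp
      next
        assume "act vs = act (ws @ [s])"
        then have "act (v @ vs) = act (us @ [s])" by (simp add: fun_eq_iff vws[symmetric])
        then show "length ws \<le> length vs"
          using len_append_le[OF v(1) vs'] len_v less.prems(3) by simp
      }
    qed
    have "act us (\<alpha> s) = p *\<^sub>R act v (\<alpha> s) + q *\<^sub>R act v (\<alpha> t)"
      by (simp add: vws[symmetric] pq(3) linear_add[OF linear_act] linear_cmul[OF linear_act])
    then show ?thesis
      using gap_cone_combination[OF * * pq(1,2)] by simp
  qed
qed

section \<open>The positive cone and the discreteness of dominant orbits\<close>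

definition positive_cone :: "'v set" where
  "positive_cone = {\<Sum>s\<in>S. k s *\<^sub>R \<alpha> s | k. \<forall>s\<in>S. 0 \<le> k s}"

lemma gap_cone_positive: "x \<in> gap_cone \<Longrightarrow> x \<in> positive_cone"
  unfolding gap_cone_def positive_cone_def by force

lemma positive_cone_add:
  assumes "x \<in> positive_cone" "y \<in> positive_cone"
  shows "x + y \<in> positive_cone"
proof -
  obtain k l where k: "x = (\<Sum>s\<in>S. k s *\<^sub>R \<alpha> s)" "\<And>s. s \<in> S \<Longrightarrow> 0 \<le> k s"
    and l: "y = (\<Sum>s\<in>S. l s *\<^sub>R \<alpha> s)" "\<And>s. s \<in> S \<Longrightarrow> 0 \<le> l s"
    using assms unfolding positive_cone_def by blast
  then have "x + y = (\<Sum>s\<in>S. (k s + l s) *\<^sub>R \<alpha> s)"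
    by (simp add: sum.distrib scaleR_add_left)
  then show ?thesis
    using k(2) l(2) unfolding positive_cone_def
    by (intro CollectI exI[of _ "\<lambda>s. k s + l s"]) auto
qed

lemma positive_cone_scale:
  assumes "x \<in> positive_cone" "0 \<le> r"
  shows "r *\<^sub>R x \<in> positive_cone"
proof -
  obtain k where k: "x = (\<Sum>s\<in>S. k s *\<^sub>R \<alpha> s)" "\<And>s. s \<in> S \<Longrightarrow> 0 \<le> k s"
    using assms unfolding positive_cone_def by blast
  then have "r *\<^sub>R x = (\<Sum>s\<in>S. (r * k s) *\<^sub>R \<alpha> s)"
    by (simp add: scaleR_sum_right)
  then show ?thesis
    using k(2) assms(2) unfolding positive_cone_def
    by (intro CollectI exI[of _ "\<lambda>s. r * k s"]) auto
qed

text \<open>Dropping the last letter \<open>t\<close> of a reduced word changes the difference by a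
  nonnegative multiple of the image of \<open>\<alpha> t\<close> under the rest, a positive root by
  \<open>root_in_gap_cone\<close>.\<close>

lemma dominant_minus_act:
  assumes p: "\<And>s. s \<in> S \<Longrightarrow> 0 \<le> b p (\<alpha> s)" and "us \<in> lists S"
  shows "p - act us p \<in> positive_cone"
  using assms(2)
proof (induction "len (act us)" arbitrary: us rule: less_induct)
  case less
  obtain rs where rs: "rs \<in> lists S" "length rs = len (act us)" "act rs = act us"
    using less.prems by (rule reduced_word)
  show ?case
  proof (cases rs rule: rev_cases)
    case Nil
    have "p - act us p = (\<Sum>s\<in>S. 0 *\<^sub>R \<alpha> s)" using rs(3)[symmetric] Nil by simp
    then show ?thesis unfolding positive_cone_def
      by (intro CollectI exI[of _ "\<lambda>_. 0"]) simp
  next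
    case (snoc gs t)
    have gs: "gs \<in> lists S" "t \<in> S" using rs snoc by auto
    have len_gs: "len (act gs) < len (act us)"
      using len_le[OF gs(1)] rs snoc by simp
    moreover have "act (gs @ [t]) = act us" using rs snoc by simp
    ultimately have "act gs (\<alpha> t) \<in> gap_cone"
      using root_in_gap_cone[OF gs] by simp
    moreover have "p - act us p = (p - act gs p) + (2 * b p (\<alpha> t)) *\<^sub>R act gs (\<alpha> t)"
      using gs by (simp add: rs(3)[symmetric] snoc reflection_eq linear_diff[OF linear_act]
        linear_cmul[OF linear_act])
    moreover have "p - act gs p \<in> positive_cone"
      using less.hyps[OF len_gs gs(1)] .
    ultimately show ?thesis
      using p[OF gs(2)] positive_cone_add positive_cone_scale[OF gap_cone_positive]
      by (simp only:)
  qed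
qed

text \<open>A nonzero pairing has a term with coefficient at least 1, so it is at least the least
  nonzero pairing of \<open>p\<close> with a simple root. Inserting 1 keeps the minimum
  defined.\<close>

lemma dominant_gap:
  assumes p: "\<And>s. s \<in> S \<Longrightarrow> 0 \<le> b p (\<alpha> s)"
  obtains \<epsilon> where "\<epsilon> > 0" "\<And>x. x \<in> gap_cone \<Longrightarrow> b p x = 0 \<or> \<epsilon> \<le> b p x"
proof -
  define \<epsilon> where "\<epsilon> = Min (insert 1 ((\<lambda>s. b p (\<alpha> s)) ` {s \<in> S. b p (\<alpha> s) \<noteq> 0}))"
  have \<epsilon>: "\<epsilon> \<le> b p (\<alpha> s)" if "s \<in> S" "b p (\<alpha> s) \<noteq> 0" for s
    unfolding \<epsilon>_def using finite_S that by (intro Min_le) auto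
  have "\<epsilon> > 0"
    unfolding \<epsilon>_def using finite_S p by (subst Min_gr_iff) (auto simp: less_le)
  moreover have "b p x = 0 \<or> \<epsilon> \<le> b p x" if x_in: "x \<in> gap_cone" for x
  proof -
    obtain k where x: "x = (\<Sum>s\<in>S. k s *\<^sub>R \<alpha> s)" and k: "\<And>s. s \<in> S \<Longrightarrow> zero_or_ge_1 (k s)"
      using x_in unfolding gap_cone_def by blast
    have bx: "b p x = (\<Sum>s\<in>S. k s * b p (\<alpha> s))" by (simp add: x b_sum_right)
    have nonneg: "0 \<le> k s * b p (\<alpha> s)" if "s \<in> S" for s
      using p[OF that] k[OF that] by auto
    show ?thesis
    proof (cases "\<exists>s\<in>S. k s * b p (\<alpha> s) \<noteq> 0")
      case True
      then obtain s where s: "s \<in> S" "k s \<noteq> 0" "b p (\<alpha> s) \<noteq> 0" by auto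
      then have "1 \<le> k s" using k by blast
      then have "\<epsilon> \<le> k s * b p (\<alpha> s)"
        using \<epsilon>[OF s(1,3)] mult_right_mono[of 1 "k s" "b p (\<alpha> s)"] p[OF s(1)] by simp
      also have "\<dots> \<le> b p x"
        unfolding bx using s finite_S nonneg by (intro member_le_sum) auto
      finally show ?thesis ..
    next
      case False
      then show ?thesis
        unfolding bx by (intro disjI1 sum.neutral) auto
    qed
  qed
  ultimately show ?thesis using that by blast
qed

lemma finite_dominant_orbit:
  assumes p: "\<And>s. s \<in> S \<Longrightarrow> 0 \<le> b p (\<alpha> s)" and u: "\<And>s. s \<in> S \<Longrightarrow> 0 < b u (\<alpha> s)"
  shows "finite {act us p | us. us \<in> lists S \<and> M \<le> b u (act us p)}"
proof -
  obtain \<epsilon> where \<epsilon>: "\<epsilon> > 0" "\<And>x. x \<in> gap_cone \<Longrightarrow> b p x = 0 \<or> \<epsilon> \<le> b p x"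
    using p by (rule dominant_gap) auto
  define \<delta> where "\<delta> = Min (insert 1 ((\<lambda>s. b u (\<alpha> s)) ` S))"
  have \<delta>: "\<delta> > 0" "\<And>s. s \<in> S \<Longrightarrow> \<delta> \<le> b u (\<alpha> s)"
    unfolding \<delta>_def using finite_S u by (auto intro: Min_le)
  have step: "\<exists>ws\<in>lists S. act us p = act ws p \<and> b u (act us p) \<le> b u p - real (length ws) * (2 * \<epsilon> * \<delta>)"
    if "us \<in> lists S" for us
    using that
  proof (induction "len (act us)" arbitrary: us rule: less_induct)
    case less
    obtain rs where rs: "rs \<in> lists S" "length rs = len (act us)" "act rs = act us"
      using less.prems by (rule reduced_word)
    show ?case
    proof (cases rs)
      case Nil
      then show ?thesis using rs(3)[symmetric] by (intro bexI[of _ "[]"]) auto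
    next
      case (Cons t gs)
      have gs: "gs \<in> lists S" "t \<in> S" using rs Cons by auto
      have rgs: "rev gs \<in> lists S" using gs by (auto simp: in_lists_conv_set)
      have len_gs: "len (act gs) < len (act us)"
        using len_le[OF gs(1)] rs Cons by simp
      then obtain ws where ws: "ws \<in> lists S" "act gs p = act ws p"
        "b u (act gs p) \<le> b u p - real (length ws) * (2 * \<epsilon> * \<delta>)"
        using less.hyps gs by blast
      \<comment> \<open>By adjointness the pairing with \<open>\<alpha> t\<close> becomes the
        pairing of \<open>p\<close> with a root, positive because \<open>t\<close> lengthens the
        inverse of \<open>gs\<close>.\<close>
      have "len (act (rev gs @ [t])) = len (act rs)"
        using len_rev[OF rs(1)] Cons by simp
      then have "act (rev gs) (\<alpha> t) \<in> gap_cone"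
        using root_in_gap_cone[OF rgs gs(2)] len_rev[OF gs(1)] len_gs rs(3) by simp
      moreover have "b (act gs p) (\<alpha> t) = b p (act (rev gs) (\<alpha> t))"
        using gs(1) by (rule act_adjoint)
      ultimately have cases: "b (act gs p) (\<alpha> t) = 0 \<or> \<epsilon> \<le> b (act gs p) (\<alpha> t)"
        using \<epsilon>(2) by simp
      have us: "act us p = act gs p - (2 * b (act gs p) (\<alpha> t)) *\<^sub>R \<alpha> t"
        using gs by (simp add: rs(3)[symmetric] Cons reflection_eq)
      from cases show ?thesis
      proof
        assume "b (act gs p) (\<alpha> t) = 0"
        then show ?thesis using us ws by (intro bexI[of _ ws]) auto
      next
        assume ge: "\<epsilon> \<le> b (act gs p) (\<alpha> t)"
        have "\<epsilon> * \<delta> \<le> b (act gs p) (\<alpha> t) * b u (\<alpha> t)"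
          using ge \<delta> \<epsilon>(1) gs by (intro mult_mono) auto
        then have "b u (act us p) \<le> b u p - real (length (t # ws)) * (2 * \<epsilon> * \<delta>)"
          using ws(3) by (simp add: us b_simps algebra_simps)
        moreover have "act us p = act (t # ws) p"
          using rs(3)[symmetric] Cons ws(2) by simp
        ultimately show ?thesis using ws(1) gs(2) by (intro bexI[of _ "t # ws"]) auto
      qed
    qed
  qed
  define N where "N = nat \<lceil>(b u p - M) / (2 * \<epsilon> * \<delta>)\<rceil>"
  have "{act us p | us. us \<in> lists S \<and> M \<le> b u (act us p)}
    \<subseteq> (\<lambda>ws. act ws p) ` {ws. set ws \<subseteq> S \<and> length ws \<le> N}"
  proof
    fix x assume "x \<in> {act us p | us. us \<in> lists S \<and> M \<le> b u (act us p)}"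
    then obtain us where us: "us \<in> lists S" "M \<le> b u (act us p)" and x: "x = act us p"
      by blast
    obtain ws where ws: "ws \<in> lists S" "act us p = act ws p"
      "b u (act us p) \<le> b u p - real (length ws) * (2 * \<epsilon> * \<delta>)" using step[OF us(1)] by blast
    have "0 < 2 * \<epsilon> * \<delta>" using \<epsilon> \<delta> by simp
    moreover have "real (length ws) * (2 * \<epsilon> * \<delta>) \<le> b u p - M" using us ws by simp
    ultimately have "real (length ws) \<le> (b u p - M) / (2 * \<epsilon> * \<delta>)"
      by (simp add: pos_le_divide_eq)
    then have "length ws \<le> N" unfolding N_def by linarith
    then show "x \<in> (\<lambda>ws. act ws p) ` {ws. set ws \<subseteq> S \<and> length ws \<le> N}"
      using ws x by (auto simp: in_lists_conv_set)
  qed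
  then show ?thesis
    by (rule finite_subset) (intro finite_imageI finite_lists_length_le[OF finite_S])
qed

end

section \<open>Fundamental weights and timelike vectors\<close>

context lorentzian_coxeter_system
begin

lemma card_simple: "card S = DIM('v)"
  using simple_inj simple_independent simple_span
  by (metis card_image dim_UNIV dim_eq_card_independent dim_span)

lemma orthogonal_isotropic_span:
  "b x x \<le> 0 \<Longrightarrow> x \<noteq> 0 \<Longrightarrow> b y y \<le> 0 \<Longrightarrow> b x y = 0 \<Longrightarrow> y \<in> span {x}"
  using lorentzian_orthogonal_isotropic[OF form_bilinear form_sym] lorentzian
  unfolding card_simple by blast

lemma timelike_exists: obtains e where "b e e < 0"
proof -
  obtain E where "card {x \<in> E. b x x < 0} = 1"
    using lorentzian unfolding has_signature_def by blast
  then show ?thesis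
    using that by (metis (no_types, lifting) card_1_singletonE insertI1 mem_Collect_eq)
qed

section \<open>Coordinates in the simple roots and the dual basis\<close>

lemma simple_expansion: obtains k where "x = (\<Sum>s\<in>S. k s *\<^sub>R \<alpha> s)"
proof -
  have "x \<in> span (\<alpha> ` S)" using simple_span by simp
  then obtain k where "x = (\<Sum>v\<in>\<alpha> ` S. k v *\<^sub>R v)"
    using span_finite[of "\<alpha> ` S"] finite_S by auto
  then have "x = (\<Sum>s\<in>S. k (\<alpha> s) *\<^sub>R \<alpha> s)"
    by (simp add: sum.reindex[OF simple_inj])
  then show ?thesis by (rule that)
qed

lemma simple_coefficients_zero:
  assumes "(\<Sum>s\<in>S. k s *\<^sub>R \<alpha> s) = 0" "s \<in> S"
  shows "k s = 0"
proof -
  define l where "l v = k (inv_into S \<alpha> v)" for v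
  have l: "l (\<alpha> t) = k t" if "t \<in> S" for t
    using that simple_inj by (simp add: l_def inv_into_f_f)
  have "(\<Sum>v\<in>\<alpha> ` S. l v *\<^sub>R v) = 0"
    using assms(1) by (simp add: sum.reindex[OF simple_inj] l)
  then have "l (\<alpha> s) = 0"
    using simple_independent finite_S assms(2) by (auto simp: dependent_finite)
  then show ?thesis using l assms(2) by simp
qed

text \<open>A nonzero vector of the radical is isotropic and orthogonal to a timelike
  \<open>e\<close>; then \<open>e\<close> is a multiple of it and has square 0.\<close>

lemma nondegenerate:
  assumes x: "\<And>s. s \<in> S \<Longrightarrow> b x (\<alpha> s) = 0"
  shows "x = 0"
proof (rule ccontr)
  assume "x \<noteq> 0"
  have orth: "b x y = 0" for y
  proof -
    obtain k where "y = (\<Sum>s\<in>S. k s *\<^sub>R \<alpha> s)" by (rule simple_expansion)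
    then show ?thesis using x by (simp add: b_sum_right)
  qed
  obtain e where e: "b e e < 0" by (rule timelike_exists)
  then have "e \<in> span {x}"
    using orthogonal_isotropic_span[of x e] orth \<open>x \<noteq> 0\<close> by simp
  then obtain r where "e = r *\<^sub>R x" by (auto simp: span_singleton)
  then show False using e orth by (simp add: b_simps)
qed

abbreviation \<omega> :: "'w \<Rightarrow> 'v" where
  "\<omega> \<equiv> fundamental_weight S \<alpha> b"

text \<open>Makes the definite description meaningful. The map \<open>f\<close>, which uses the
  pairings of \<open>x\<close> as coordinates, is injective by nondegeneracy, hence surjective; a
  preimage of \<open>\<alpha> t\<close> is the dual vector.\<close>

lemma fundamental_weight_pairing:
  assumes "t \<in> S" "s \<in> S"
  shows "b (\<alpha> s) (\<omega> t) = (if s = t then 1 else 0)"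
proof -
  let ?P = "\<lambda>x. \<forall>s\<in>S. b (\<alpha> s) x = (if s = t then 1 else 0)"
  define f where "f x = (\<Sum>s\<in>S. b (\<alpha> s) x *\<^sub>R \<alpha> s)" for x
  have lin: "linear f"
    unfolding f_def by (rule linearI)
      (simp_all add: b_simps scaleR_add_left sum.distrib scaleR_sum_right)
  have "inj f"
  proof (subst linear_injective_0[OF lin], intro allI impI)
    fix x assume "f x = 0"
    then have "b x (\<alpha> s) = 0" if "s \<in> S" for s
      using simple_coefficients_zero[of "\<lambda>s. b (\<alpha> s) x" s] that form_sym[of x] by (simp add: f_def)
    then show "x = 0" by (rule nondegenerate)
  qed
  then have "surj f" by (rule linear_inj_imp_surj[OF lin])
  then obtain x where "\<alpha> t = f x" by (metis surjD)
  then have "(\<Sum>s\<in>S. (b (\<alpha> s) x - (if s = t then 1 else 0)) *\<^sub>R \<alpha> s) = 0"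
    using assms(1) finite_S
    by (simp add: f_def scaleR_diff_left sum_subtractf if_distrib[of "\<lambda>k. k *\<^sub>R _"] cong: if_cong)
  then have "b (\<alpha> s) x - (if s = t then 1 else 0) = 0" if "s \<in> S" for s
    using that by (rule simple_coefficients_zero)
  then have x: "?P x" by auto
  have "y = x" if "?P y" for y
  proof -
    have "b (y - x) (\<alpha> s) = 0" if "s \<in> S" for s
      using \<open>?P y\<close> x that form_sym[of _ "\<alpha> s"] by (simp add: b_simps)
    then have "y - x = 0" by (rule nondegenerate)
    then show ?thesis by simp
  qed
  with x have "?P (THE x. ?P x)" by (rule theI)
  then show ?thesis using assms(2) unfolding fundamental_weight_def by blast
qed

lemma coordinate: "t \<in> S \<Longrightarrow> b (\<Sum>s\<in>S. k s *\<^sub>R \<alpha> s) (\<omega> t) = k t"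
  using finite_S form_sym[of _ "\<omega> t"] fundamental_weight_pairing[of t]
  by (simp add: b_sum_right if_distrib[of "times _"] cong: if_cong sum.cong)

lemma coordinate_expansion: "x = (\<Sum>s\<in>S. b x (\<omega> s) *\<^sub>R \<alpha> s)"
proof -
  obtain k where "x = (\<Sum>s\<in>S. k s *\<^sub>R \<alpha> s)" by (rule simple_expansion)
  then show ?thesis using coordinate[of _ k] by simp
qed

lemma mem_positive_cone_iff: "x \<in> positive_cone \<longleftrightarrow> (\<forall>s\<in>S. 0 \<le> b x (\<omega> s))"
proof
  show "x \<in> positive_cone \<Longrightarrow> \<forall>s\<in>S. 0 \<le> b x (\<omega> s)"
    unfolding positive_cone_def by (auto simp: coordinate)
  show "\<forall>s\<in>S. 0 \<le> b x (\<omega> s) \<Longrightarrow> x \<in> positive_cone"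
    unfolding positive_cone_def using coordinate_expansion[of x]
    by (intro CollectI exI[of _ "\<lambda>s. b x (\<omega> s)"]) auto
qed

lemma simple_pairing_nonpos:
  assumes "s \<in> S" "t \<in> S" "s \<noteq> t"
  shows "b (\<alpha> s) (\<alpha> t) \<le> 0"
proof (cases "m s t")
  case (enat n)
  then have "2 \<le> n" using m_ge_2[OF assms] by (simp add: numeral_eq_enat)
  then have "pi / real n \<le> pi / 2" by (intro divide_left_mono) auto
  then have "0 \<le> cos (pi / real n)"
    by (intro cos_ge_zero) (auto intro: order_trans[of _ 0])
  then show ?thesis using assms enat by (simp add: form_simple coxeter_entry_def)
next
  case infinity
  then show ?thesis using assms c_ge_1[of s t] by (simp add: form_simple coxeter_entry_def)
qed

lemma tendsto_b: "(f \<longlongrightarrow> x) F \<Longrightarrow> (g \<longlongrightarrow> y) F \<Longrightarrow> ((\<lambda>i. b (f i) (g i)) \<longlongrightarrow> b x y) F"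
  using form_bilinear[unfolded bilinear_conv_bounded_bilinear] by (rule bounded_bilinear.tendsto)

text \<open>Since the off-diagonal entries are nonpositive, taking absolute values of the coordinates
  does not increase \<open>b x x\<close>. So the least eigenvalue, which is negative, has an eigenvector with
  nonnegative coordinates (Perron-Frobenius).\<close>
lemma timelike_dominant_exists:
  obtains v where "b v v < 0" "\<And>s. s \<in> S \<Longrightarrow> 0 \<le> b v (\<alpha> s)"
proof -
  define N where "N x = (\<Sum>s\<in>S. (b x (\<omega> s))\<^sup>2)" for x
  have N_pos: "N x > 0" if "x \<noteq> 0" for x
  proof -
    have "\<exists>s\<in>S. b x (\<omega> s) \<noteq> 0"
      using coordinate_expansion[of x] that by (metis (no_types, lifting) scale_zero_left sum.neutral)
    then show ?thesis
      unfolding N_def using finite_S by (auto intro!: sum_pos2)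
  qed
  have scale: "N (r *\<^sub>R x) = r\<^sup>2 * N x" "b (r *\<^sub>R x) (r *\<^sub>R x) = r\<^sup>2 * b x x" for r x
    by (simp_all add: N_def b_simps power_mult_distrib sum_distrib_left power2_eq_square mult_ac)
  have compact: "compact {x. N x = 1}"
    unfolding compact_eq_bounded_closed
  proof
    have "norm x \<le> (\<Sum>s\<in>S. norm (\<alpha> s))" if "N x = 1" for x
    proof -
      have "\<bar>b x (\<omega> s)\<bar> \<le> 1" if "s \<in> S" for s
      proof -
        have "(b x (\<omega> s))\<^sup>2 \<le> N x"
          unfolding N_def using that finite_S by (intro member_le_sum) auto
        then show ?thesis using \<open>N x = 1\<close> by (simp add: abs_square_le_1)
      qed
      then have "norm (\<Sum>s\<in>S. b x (\<omega> s) *\<^sub>R \<alpha> s) \<le> (\<Sum>s\<in>S. norm (\<alpha> s))"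
        by (intro sum_norm_le) (simp add: mult_left_le_one_le)
      then show ?thesis using coordinate_expansion[of x] by simp
    qed
    then show "bounded {x. N x = 1}" by (auto intro: boundedI)
    have "continuous_on UNIV N"
      unfolding N_def continuous_on_def by (intro ballI tendsto_intros tendsto_b)
    then show "closed {x. N x = 1}"
      by (intro closed_Collect_eq continuous_on_const)
  qed
  obtain e where e: "b e e < 0" by (rule timelike_exists)
  then have "e \<noteq> 0" by (auto simp: b_simps)
  define e' where "e' = (1 / sqrt (N e)) *\<^sub>R e"
  have e': "N e' = 1" "b e' e' < 0"
    using N_pos[OF \<open>e \<noteq> 0\<close>] e by (simp_all add: e'_def scale power_divide divide_less_0_iff)
  have "continuous_on {x. N x = 1} (\<lambda>x. b x x)"
    unfolding continuous_on_def by (intro ballI tendsto_intros tendsto_b)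
  then obtain x where x: "N x = 1" and min: "\<And>y. N y = 1 \<Longrightarrow> b x x \<le> b y y"
    using continuous_attains_inf[OF compact] e'(1) by (metis (mono_tags, lifting) empty_iff mem_Collect_eq)
  define \<mu> where "\<mu> = b x x"
  have "\<mu> < 0" using min[OF e'(1)] e'(2) by (simp add: \<mu>_def)
  have rayleigh: "\<mu> * N y \<le> b y y" for y
  proof (cases "y = 0")
    case True
    then show ?thesis by (simp add: N_def b_simps)
  next
    case False
    then have "N ((1 / sqrt (N y)) *\<^sub>R y) = 1"
      using N_pos[of y] by (simp add: scale power_divide)
    then have "\<mu> \<le> (1 / sqrt (N y))\<^sup>2 * b y y"
      unfolding \<mu>_def scale(2)[symmetric] by (rule min)
    then show ?thesis using N_pos[OF False] by (simp add: power_divide pos_le_divide_eq)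
  qed
  define y where "y = (\<Sum>s\<in>S. \<bar>b x (\<omega> s)\<bar> *\<^sub>R \<alpha> s)"
  have y\<omega>: "b y (\<omega> s) = \<bar>b x (\<omega> s)\<bar>" if "s \<in> S" for s
    unfolding y_def using that by (rule coordinate)
  have "N y = 1" using x by (simp add: N_def y\<omega>)
  have quad: "b z z = (\<Sum>s\<in>S. \<Sum>t\<in>S. b z (\<omega> s) * b z (\<omega> t) * b (\<alpha> s) (\<alpha> t))" for z
  proof -
    have "b z z = (\<Sum>s\<in>S. b z (\<omega> s) * b z (\<alpha> s))"
      by (subst (2) coordinate_expansion[of z]) (rule b_sum_right)
    also have "\<dots> = (\<Sum>s\<in>S. b z (\<omega> s) * (\<Sum>t\<in>S. b z (\<omega> t) * b (\<alpha> s) (\<alpha> t)))"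
    proof (rule sum.cong)
      fix s
      have "b (\<alpha> s) z = (\<Sum>t\<in>S. b z (\<omega> t) * b (\<alpha> s) (\<alpha> t))"
        by (subst coordinate_expansion[of z]) (rule b_sum_right)
      then show "b z (\<omega> s) * b z (\<alpha> s) = b z (\<omega> s) * (\<Sum>t\<in>S. b z (\<omega> t) * b (\<alpha> s) (\<alpha> t))"
        using form_sym[of z "\<alpha> s"] by simp
    qed simp
    finally show ?thesis by (simp add: sum_distrib_left mult.assoc)
  qed
  have "b y y \<le> \<mu>"
    unfolding \<mu>_def quad[of y] quad[of x]
  proof (intro sum_mono)
    fix s t assume st: "s \<in> S" "t \<in> S"
    show "b y (\<omega> s) * b y (\<omega> t) * b (\<alpha> s) (\<alpha> t) \<le> b x (\<omega> s) * b x (\<omega> t) * b (\<alpha> s) (\<alpha> t)"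
    proof (cases "s = t")
      case True
      then show ?thesis using st by (simp add: y\<omega>)
    next
      case False
      have "b x (\<omega> s) * b x (\<omega> t) \<le> \<bar>b x (\<omega> s)\<bar> * \<bar>b x (\<omega> t)\<bar>"
        by (metis abs_ge_self abs_mult)
      then show ?thesis
        using simple_pairing_nonpos[OF st False] st by (simp add: y\<omega> mult_right_mono_neg)
    qed
  qed
  then have "b y y = \<mu>" using rayleigh[of y] \<open>N y = 1\<close> by simp
  have eigen: "b y (\<alpha> s) = \<mu> * b y (\<omega> s)" if s: "s \<in> S" for s
  proof -
    define A where "A = b y (\<alpha> s) - \<mu> * b y (\<omega> s)"
    \<comment> \<open>The minimizer of \<open>2 * r * A + r\<^sup>2 * (1 - \<mu>)\<close>, which
      \<open>rayleigh\<close> keeps nonnegative; the minimum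
      \<open>- A\<^sup>2 / (1 - \<mu>)\<close> forces \<open>A = 0\<close>.\<close>
    define r where "r = - A / (1 - \<mu>)"
    have "N (y + r *\<^sub>R \<alpha> s) = (\<Sum>t\<in>S. (b y (\<omega> t))\<^sup>2 + (if s = t then 2 * r * b y (\<omega> s) + r\<^sup>2 else 0))"
      unfolding N_def using s
      by (intro sum.cong) (auto simp: b_simps fundamental_weight_pairing power2_sum)
    then have "N (y + r *\<^sub>R \<alpha> s) = 1 + 2 * r * b y (\<omega> s) + r\<^sup>2"
      using \<open>N y = 1\<close> s finite_S by (simp add: sum.distrib N_def)
    moreover have "b (y + r *\<^sub>R \<alpha> s) (y + r *\<^sub>R \<alpha> s) = \<mu> + 2 * r * b y (\<alpha> s) + r\<^sup>2"
      using \<open>b y y = \<mu>\<close> s form_sym[of "\<alpha> s" y]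
      by (simp add: b_simps simple_norm power2_eq_square algebra_simps)
    ultimately have "0 \<le> 2 * r * A + r\<^sup>2 * (1 - \<mu>)"
      using rayleigh[of "y + r *\<^sub>R \<alpha> s"] by (simp add: A_def algebra_simps)
    also have "\<dots> = 2 * r * A + r * (r * (1 - \<mu>))"
      by (simp add: power2_eq_square)
    also have "r * (1 - \<mu>) = - A"
      using \<open>\<mu> < 0\<close> by (simp add: r_def)
    also have "2 * r * A + r * - A = - (A\<^sup>2 / (1 - \<mu>))"
      by (simp add: r_def power2_eq_square)
    finally have "A\<^sup>2 \<le> 0"
      using \<open>\<mu> < 0\<close> by (simp add: divide_le_0_iff)
    then show ?thesis by (simp add: A_def)
  qed
  \<comment> \<open>The sign flips because the eigenvalue is negative: nonnegative coordinates of
    \<open>y\<close> give nonpositive pairings.\<close>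
  show ?thesis
  proof (rule that[of "- y"])
    show "b (- y) (- y) < 0" using \<open>b y y = \<mu>\<close> \<open>\<mu> < 0\<close> by (simp add: b_simps)
    show "0 \<le> b (- y) (\<alpha> s)" if "s \<in> S" for s
      using eigen[OF that] y\<omega>[OF that] \<open>\<mu> < 0\<close> by (simp add: b_simps mult_nonpos_nonneg)
  qed
qed

text \<open>The sum \<open>w\<close> of the fundamental weights pairs to 1 with every simple root.
  Adding a small multiple makes the inequalities strict and keeps the vector timelike; rescaling
  gives square -1.\<close>

lemma timelike_strictly_dominant_exists:
  obtains v where "b v v = -1" "\<And>s. s \<in> S \<Longrightarrow> 0 < b v (\<alpha> s)"
proof -
  obtain v where v: "b v v < 0" "\<And>s. s \<in> S \<Longrightarrow> 0 \<le> b v (\<alpha> s)"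
    by (rule timelike_dominant_exists) blast
  define w where "w = (\<Sum>s\<in>S. 1 *\<^sub>R \<omega> s)"
  have w: "b (\<alpha> s) w = 1" if "s \<in> S" for s
    unfolding w_def b_sum_right
    using that finite_S fundamental_weight_pairing[OF _ that] by (simp cong: sum.cong)
  have "((\<lambda>\<epsilon>. b (v + \<epsilon> *\<^sub>R w) (v + \<epsilon> *\<^sub>R w)) \<longlongrightarrow> b (v + 0 *\<^sub>R w) (v + 0 *\<^sub>R w)) (at_right 0)"
    by (intro tendsto_b tendsto_intros)
  then have "\<forall>\<^sub>F \<epsilon> in at_right 0. b (v + \<epsilon> *\<^sub>R w) (v + \<epsilon> *\<^sub>R w) < 0"
    using v(1) order_tendstoD(2)[of _ "b v v" _ 0] by simp
  moreover have "\<forall>\<^sub>F \<epsilon>::real in at_right 0. 0 < \<epsilon>"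
    by (rule eventually_at_right_less)
  ultimately have "\<forall>\<^sub>F \<epsilon> in at_right 0. b (v + \<epsilon> *\<^sub>R w) (v + \<epsilon> *\<^sub>R w) < 0 \<and> 0 < \<epsilon>"
    by eventually_elim simp
  then obtain \<epsilon> where \<epsilon>: "b (v + \<epsilon> *\<^sub>R w) (v + \<epsilon> *\<^sub>R w) < 0" "0 < \<epsilon>"
    using eventually_happens[of _ "at_right (0::real)"] by auto
  define v' where "v' = v + \<epsilon> *\<^sub>R w"
  have v': "b v' v' < 0" using \<epsilon> by (simp add: v'_def)
  have "0 < b v' (\<alpha> s)" if "s \<in> S" for s
    using v(2)[OF that] w[OF that] form_sym[of w "\<alpha> s"] \<epsilon>(2) by (simp add: v'_def b_simps)
  then show ?thesis
    using v' that[of "(1 / sqrt (- b v' v')) *\<^sub>R v'"] by (simp add: b_simps)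
qed

end

section \<open>Limit directions\<close>

locale timelike_coxeter_system = lorentzian_coxeter_system W S m \<rho> c \<alpha> b
  for W :: "('w, 'x) monoid_scheme" (structure)
    and S :: "'w set" and m :: "'w \<Rightarrow> 'w \<Rightarrow> enat"
    and \<rho> :: "'w \<Rightarrow> 'v::euclidean_space \<Rightarrow> 'v"
    and c :: "'w \<Rightarrow> 'w \<Rightarrow> real"
    and \<alpha> :: "'w \<Rightarrow> 'v"
    and b :: "'v \<Rightarrow> 'v \<Rightarrow> real" +
  fixes u :: 'v
  assumes u_norm: "b u u = -1"
    and u_dominant: "\<And>s. s \<in> S \<Longrightarrow> 0 < b u (\<alpha> s)"
begin

sublocale lorentzian_form b u
  by unfold_locales (use form_bilinear form_sym u_norm orthogonal_isotropic_span in auto)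

section \<open>Orbits and the limit directions of the orbit of u\<close>

abbreviation orbit_of :: "'v set \<Rightarrow> 'v set" where
  "orbit_of \<equiv> orbit_set W \<rho>"

lemma mem_orbit: "us \<in> lists S \<Longrightarrow> x \<in> X \<Longrightarrow> act us x \<in> orbit_of X"
  unfolding orbit_set_eq by blast

lemma orbit_form_bounded:
  assumes "finite X"
  obtains M where "\<And>x. x \<in> orbit_of X \<Longrightarrow> \<bar>b x x\<bar> \<le> M"
proof
  fix x assume "x \<in> orbit_of X"
  then obtain us y where "us \<in> lists S" "y \<in> X" "x = act us y"
    unfolding orbit_set_eq by blast
  then have "\<bar>b x x\<bar> = \<bar>b y y\<bar>" by (simp add: act_isometry)
  also have "\<dots> \<le> (\<Sum>y\<in>X. \<bar>b y y\<bar>)"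
    using \<open>y \<in> X\<close> assms by (intro member_le_sum) auto
  finally show "\<bar>b x x\<bar> \<le> (\<Sum>y\<in>X. \<bar>b y y\<bar>)" .
qed

lemma finite_orbit_bounded:
  assumes X: "finite X" and dom: "\<And>p s. p \<in> X \<Longrightarrow> s \<in> S \<Longrightarrow> 0 \<le> b p (\<alpha> s)"
  shows "finite {x \<in> orbit_of X. \<bar>b u x\<bar> \<le> M}"
proof (rule finite_subset)
  show "finite (\<Union>p\<in>X. {act us p | us. us \<in> lists S \<and> - M \<le> b u (act us p)})"
    using X dom u_dominant by (intro finite_UN_I finite_dominant_orbit) auto
  show "{x \<in> orbit_of X. \<bar>b u x\<bar> \<le> M} \<subseteq> (\<Union>p\<in>X. {act us p | us. us \<in> lists S \<and> - M \<le> b u (act us p)})"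
    unfolding orbit_set_eq by force
qed

lemma u_orbit_bounded: "finite {x \<in> orbit_of {u}. \<bar>b u x\<bar> \<le> M}"
  using u_dominant by (intro finite_orbit_bounded) (auto intro: less_imp_le)

lemma u_orbit_norm:
  assumes "x \<in> orbit_of {u}"
  shows "\<bar>b x x\<bar> \<le> 1"
proof -
  obtain us where "us \<in> lists S" "x = act us u"
    using assms unfolding orbit_set_eq by blast
  then show ?thesis by (simp add: act_isometry u_norm)
qed

lemma positive_cone_pairing:
  assumes "x \<in> positive_cone"
  shows "0 \<le> b u x" and "x \<noteq> 0 \<Longrightarrow> 0 < b u x"
proof -
  have bux: "b u x = (\<Sum>s\<in>S. b x (\<omega> s) * b u (\<alpha> s))"
    by (subst (1) coordinate_expansion[of x]) (rule b_sum_right)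
  have nonneg: "0 \<le> b x (\<omega> s) * b u (\<alpha> s)" if "s \<in> S" for s
    using assms that u_dominant[OF that] by (simp add: mem_positive_cone_iff)
  then show "0 \<le> b u x" unfolding bux by (rule sum_nonneg)
  assume "x \<noteq> 0"
  then obtain s where s: "s \<in> S" "b x (\<omega> s) \<noteq> 0"
    using coordinate_expansion[of x] by (metis (no_types, lifting) scale_zero_left sum.neutral)
  then have "0 < b x (\<omega> s) * b u (\<alpha> s)"
    using assms u_dominant[OF s(1)] by (simp add: mem_positive_cone_iff less_le)
  then show "0 < b u x"
    unfolding bux using s(1) finite_S nonneg by (intro sum_pos2[of S s]) auto
qed

text \<open>If \<open>w\<^sub>i u\<close> tends to \<open>z\<close> in direction, and \<open>w\<^sub>i\<^sup>-\<^sup>1 u\<close> to \<open>\<eta>\<close>, then \<open>w\<^sub>i x\<close> tends to \<open>z\<close> for every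
  \<open>x\<close> not orthogonal to \<open>\<eta>\<close>.\<close>
lemma limit_directions_u_subset:
  assumes X: "finite X" and separating: "\<And>y. (\<And>x. x \<in> X \<Longrightarrow> b x y = 0) \<Longrightarrow> y = 0"
  shows "limit_directions (orbit_of {u}) \<subseteq> limit_directions (orbit_of X)"
proof
  fix L assume "L \<in> limit_directions (orbit_of {u})"
  then obtain x :: "nat \<Rightarrow> 'v" and z where range_x: "range x \<subseteq> orbit_of {u}"
    and inf: "filterlim (\<lambda>i. b u (x i)) at_infinity sequentially"
    and lim: "(\<lambda>i. x i /\<^sub>R b u (x i)) \<longlonglongrightarrow> z" and z: "b u z = 1" "b z z = 0" "L = proj_line z"
    by (rule limit_directionsD[OF _ u_orbit_bounded u_orbit_norm])
  have x: "x i \<in> orbit_of {u}" for i using range_x by auto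
  obtain w where w: "\<And>i. w i \<in> lists S" and xw: "\<And>i. x i = act (w i) u"
    using x unfolding orbit_set_eq by (simp add: set_eq_iff) metis
  \<comment> \<open>The inverse elements applied to \<open>u\<close> have the same heights as
    \<open>x i\<close>, so they too have a limit direction, \<eta>.\<close>
  define x' where "x' i = act (rev (w i)) u" for i
  have w': "rev (w i) \<in> lists S" for i using w[of i] by (auto simp: in_lists_conv_set)
  have pair: "b (act (w i) y) v = b y (act (rev (w i)) v)" for i y v
    using w by (rule act_adjoint)
  have bux': "b u (x' i) = b u (x i)" for i
    using pair[of i u u] form_sym[of u] by (simp add: x'_def xw)
  have inf': "filterlim (\<lambda>i. b u (x' i)) at_infinity sequentially"
    using inf by (simp add: bux')
  have norm': "\<bar>b (x' i) (x' i)\<bar> \<le> 1" for i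
    using w' by (simp add: x'_def act_isometry u_norm)
  obtain r \<eta> where r: "strict_mono r" and \<eta>: "(\<lambda>i. x' (r i) /\<^sub>R b u (x' (r i))) \<longlonglongrightarrow> \<eta>" "b u \<eta> = 1"
    by (rule isotropic_limit_subseq[OF inf' norm'])
  have "\<eta> \<noteq> 0" using \<eta>(2) by (auto simp: b_simps)
  then obtain p where p: "p \<in> X" "b p \<eta> \<noteq> 0" using separating by blast
  define y where "y i = act (w (r i)) p" for i
  have y_in: "y i \<in> orbit_of X" for i
    unfolding y_def using w p(1) by (rule mem_orbit)
  have inf_r: "filterlim (\<lambda>i. b u (x (r i))) at_infinity sequentially"
    using filterlim_compose[OF inf filterlim_subseq[OF r]] .
  \<comment> \<open>The height of \<open>y i\<close> equals \<open>b p (x' (r i))\<close>, which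
    grows like \<open>b p \<eta>\<close> times the height of \<open>x (r i)\<close>; the choice of
    \<open>p\<close> makes it unbounded.\<close>
  have "(\<lambda>i. b p (x' (r i) /\<^sub>R b u (x' (r i)))) \<longlonglongrightarrow> b p \<eta>"
    by (rule tendsto_form[OF tendsto_const \<eta>(1)])
  then have "filterlim (\<lambda>i. b p (x' (r i) /\<^sub>R b u (x' (r i))) * b u (x (r i))) at_infinity sequentially"
    using p(2) inf_r by (rule tendsto_mult_filterlim_at_infinity)
  moreover have "\<forall>\<^sub>F i in sequentially. b p (x' (r i) /\<^sub>R b u (x' (r i))) * b u (x (r i)) = b u (y i)"
    using filterlim_at_infinity_imp_eventually_ne[OF inf_r, of 0]
  proof eventually_elim
    case (elim i)
    have "b u (y i) = b p (x' (r i))"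
      using pair[of "r i" p u] form_sym[of u "y i"] by (simp add: y_def x'_def)
    then show ?case using elim by (simp add: b_simps bux')
  qed
  ultimately have inf_y: "filterlim (\<lambda>i. b u (y i)) at_infinity sequentially"
    using filterlim_cong by fast
  have norm_y: "\<bar>b (y i) (y i)\<bar> \<le> \<bar>b p p\<bar>" for i
    using w by (simp add: y_def act_isometry)
  obtain q z' where q: "strict_mono q" and z': "(\<lambda>i. y (q i) /\<^sub>R b u (y (q i))) \<longlonglongrightarrow> z'"
    "b u z' = 1" "b z' z' = 0"
    by (rule isotropic_limit_subseq[OF inf_y norm_y])
  have inf_yq: "filterlim (\<lambda>i. b u (y (q i))) at_infinity sequentially"
    using filterlim_compose[OF inf_y filterlim_subseq[OF q]] .
  have inf_xq: "filterlim (\<lambda>i. b u (x (r (q i)))) at_infinity sequentially"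
    using filterlim_compose[OF inf_r filterlim_subseq[OF q]] .
  have "(\<lambda>i. x (r (q i)) /\<^sub>R b u (x (r (q i)))) \<longlonglongrightarrow> z"
    using LIMSEQ_subseq_LIMSEQ[OF LIMSEQ_subseq_LIMSEQ[OF lim r] q] by (simp add: o_def)
  from tendsto_form[OF z'(1) this]
  have "(\<lambda>i. inverse (b u (y (q i))) * (inverse (b u (x (r (q i)))) * b (y (q i)) (x (r (q i))))) \<longlonglongrightarrow> b z' z"
    by (simp add: b_simps mult_ac)
  \<comment> \<open>Invariance makes this pairing constant, so after division by both heights the
    limits \<open>z'\<close> and \<open>z\<close> are orthogonal, hence equal.\<close>
  moreover have "b (y i) (x (r i)) = b p u" for i
    using w by (simp add: y_def xw act_isometry)
  ultimately have "(\<lambda>i. inverse (b u (y (q i))) * (inverse (b u (x (r (q i)))) * b p u)) \<longlonglongrightarrow> b z' z"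
    by simp
  moreover have "(\<lambda>i. inverse (b u (y (q i))) * (inverse (b u (x (r (q i)))) * b p u)) \<longlonglongrightarrow> 0 * (0 * b p u)"
    by (intro tendsto_intros filterlim_compose[OF tendsto_inverse_0 inf_yq]
        filterlim_compose[OF tendsto_inverse_0 inf_xq])
  ultimately have "b z' z = 0" using LIMSEQ_unique by fastforce
  then have "z' = z" using isotropic_unique z z' by blast
  then show "L \<in> limit_directions (orbit_of X)"
    unfolding z(3) using y_in inf_yq z'(1) z(1)
    by (intro limit_directionsI[of "\<lambda>i. y (q i)"]) (auto simp: b_simps)
qed

text \<open>Appending \<open>s\<close> lengthens either \<open>us\<close> or the word
  \<open>us @ [s]\<close>, and the latter sends \<open>\<alpha> s\<close> to the negative of the
  root.\<close>

lemma root_cases: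
  assumes "x \<in> roots W S \<rho> \<alpha>"
  shows "x \<in> gap_cone \<or> - x \<in> gap_cone"
proof -
  obtain us s where us: "us \<in> lists S" "s \<in> S" and x: "x = act us (\<alpha> s)"
    using assms unfolding roots_def orbit_set_eq by blast
  show ?thesis
  proof (cases "len (act us) \<le> len (act (us @ [s]))")
    case True
    then show ?thesis using root_in_gap_cone us x by blast
  next
    case False
    have "act (us @ [s] @ [s]) = act us"
      using us by (simp add: fun_eq_iff reflection_involution)
    then have "act (us @ [s]) (\<alpha> s) \<in> gap_cone"
      using False us by (intro root_in_gap_cone) auto
    moreover have "act (us @ [s]) (\<alpha> s) = - x"
      using us by (simp add: x reflection_eq simple_norm linear_diff[OF linear_act]
        linear_cmul[OF linear_act] linear_neg[OF linear_act] scaleR_2)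
    ultimately show ?thesis by simp
  qed
qed

lemma root_norm:
  assumes "x \<in> roots W S \<rho> \<alpha>"
  shows "b x x = 1"
proof -
  obtain us s where "us \<in> lists S" "s \<in> S" "x = act us (\<alpha> s)"
    using assms unfolding roots_def orbit_set_eq by blast
  then show ?thesis by (simp add: act_isometry simple_norm)
qed

lemma root_pairing_nonzero:
  assumes "x \<in> roots W S \<rho> \<alpha>"
  shows "b u x \<noteq> 0"
proof -
  have "x \<noteq> 0" using root_norm[OF assms] by (auto simp: b_simps)
  then show ?thesis
    using root_cases[OF assms] positive_cone_pairing(2)[OF gap_cone_positive, of x]
      positive_cone_pairing(2)[OF gap_cone_positive, of "- x"] by (auto simp: b_simps)
qed

text \<open>The reflection in the image of \<open>\<alpha> s\<close> under \<open>us\<close> is a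
  conjugate of the simple reflection, hence given by a word.\<close>

lemma root_reflection_in_orbit:
  assumes "x \<in> roots W S \<rho> \<alpha>"
  shows "u - (2 * b u x) *\<^sub>R x \<in> orbit_of {u}"
proof -
  obtain us s where us: "us \<in> lists S" "s \<in> S" and x: "x = act us (\<alpha> s)"
    using assms unfolding roots_def orbit_set_eq by blast
  have "b (act (rev us) u) (\<alpha> s) = b u x"
    using act_adjoint[OF us(1), of "\<alpha> s" u] form_sym by (simp add: x)
  then have "act (us @ [s] @ rev us) u = u - (2 * b u x) *\<^sub>R x"
    using us by (simp add: reflection_eq x linear_diff[OF linear_act] linear_cmul[OF linear_act]
      act_cancel_rev)
  moreover have "us @ [s] @ rev us \<in> lists S"
    using us by (auto simp: in_lists_conv_set)
  ultimately show ?thesis by (metis mem_orbit singletonI)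
qed

lemma root_reflection_pairing:
  "\<bar>b u (u - (2 * b u x) *\<^sub>R x)\<bar> = 1 + 2 * (b u x)\<^sup>2"
proof -
  have "b u (u - (2 * b u x) *\<^sub>R x) = - (1 + 2 * (b u x)\<^sup>2)"
    by (simp add: b_simps u_norm power2_eq_square)
  then show ?thesis by (simp only: abs_minus abs_of_nonneg add_nonneg_nonneg
    mult_nonneg_nonneg zero_le_power2 zero_le_one zero_le_numeral)
qed

text \<open>Up to sign, a root is the normalized difference of \<open>u\<close> and its mirror
  image. These images are orbit points of \<open>u\<close> of absolute height at most
  \<open>1 + 2 * M\<^sup>2\<close>, so there are finitely many.\<close>

lemma finite_roots_bounded: "finite {x \<in> roots W S \<rho> \<alpha>. \<bar>b u x\<bar> \<le> M}"
proof (rule finite_subset)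
  let ?F = "{v \<in> orbit_of {u}. \<bar>b u v\<bar> \<le> 1 + 2 * M\<^sup>2}"
  let ?g = "\<lambda>(v, e). (e / sqrt (b (u - v) (u - v))) *\<^sub>R (u - v)"
  show "finite (?g ` (?F \<times> {1, -1}))"
    using u_orbit_bounded by blast
  show "{x \<in> roots W S \<rho> \<alpha>. \<bar>b u x\<bar> \<le> M} \<subseteq> ?g ` (?F \<times> {1, -1})"
  proof clarify
    fix x assume x: "x \<in> roots W S \<rho> \<alpha>" "\<bar>b u x\<bar> \<le> M"
    define v where "v = u - (2 * b u x) *\<^sub>R x"
    have "(b u x)\<^sup>2 \<le> M\<^sup>2" using x(2) by (metis abs_ge_zero power2_abs power_mono)
    then have "v \<in> ?F"
      using root_reflection_in_orbit[OF x(1)] root_reflection_pairing[of x] by (simp add: v_def)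
    moreover have uv: "u - v = (2 * b u x) *\<^sub>R x" by (simp add: v_def)
    have "b (u - v) (u - v) = (2 * b u x)\<^sup>2"
      unfolding uv using root_norm[OF x(1)] by (simp add: b_simps power2_eq_square)
    then have "sqrt (b (u - v) (u - v)) = \<bar>2 * b u x\<bar>" by (simp only: real_sqrt_abs)
    moreover have "sgn (b u x) / \<bar>2 * b u x\<bar> * (2 * b u x) = 1"
      using root_pairing_nonzero[OF x(1)] by (simp add: sgn_real_def)
    ultimately have "v \<in> ?F" "x = ?g (v, sgn (b u x))"
      by (simp_all only: uv prod.case scaleR_scaleR scaleR_one)
    moreover have "sgn (b u x) \<in> {1, -1}"
      using root_pairing_nonzero[OF x(1)] by (simp add: sgn_real_def)
    ultimately show "x \<in> ?g ` (?F \<times> {1, -1})" by blast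
  qed
qed

text \<open>The reflection in a root \<open>x\<close> moves \<open>u\<close> by \<open>-2 b(u, x) x\<close>, which dominates \<open>u\<close> when \<open>x\<close> is large.\<close>
lemma limit_roots_subset:
  "limit_directions (roots W S \<rho> \<alpha>) \<subseteq> limit_directions (orbit_of {u})"
proof
  fix L assume "L \<in> limit_directions (roots W S \<rho> \<alpha>)"
  then obtain x :: "nat \<Rightarrow> 'v" and z where range_x: "range x \<subseteq> roots W S \<rho> \<alpha>"
    and inf: "filterlim (\<lambda>i. b u (x i)) at_infinity sequentially"
    and lim: "(\<lambda>i. x i /\<^sub>R b u (x i)) \<longlonglongrightarrow> z" and z: "b u z = 1" "b z z = 0" "L = proj_line z"
    by (rule limit_directionsD[OF _ finite_roots_bounded, of L 1]) (simp add: root_norm)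
  have x: "x i \<in> roots W S \<rho> \<alpha>" for i using range_x by auto
  define y where "y i = u - (2 * b u (x i)) *\<^sub>R x i" for i
  \<comment> \<open>Scales \<open>y i\<close> to the normalized root plus a multiple of
    \<open>u\<close> that tends to 0.\<close>
  define k where "k i = - (inverse (b u (x i)))\<^sup>2 / 2" for i
  have inv0: "(\<lambda>i. inverse (b u (x i))) \<longlonglongrightarrow> 0"
    using filterlim_compose[OF tendsto_inverse_0 inf] .
  have "filterlim (\<lambda>i. norm (b u (y i))) at_top sequentially"
  proof (rule filterlim_at_top_mono)
    show "filterlim (\<lambda>i. norm (b u (x i))) at_top sequentially"
      using inf by (simp add: filterlim_at_infinity_conv_norm_at_top)
    have "\<bar>t\<bar> \<le> 1 + 2 * t\<^sup>2" for t :: real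
    proof -
      have "0 \<le> (\<bar>t\<bar> - 1)\<^sup>2 + 3 * t\<^sup>2 + 1" by simp
      then show ?thesis by (simp add: power2_diff)
    qed
    then show "\<forall>\<^sub>F i in sequentially. norm (b u (x i)) \<le> norm (b u (y i))"
      by (simp add: y_def root_reflection_pairing)
  qed
  then have "filterlim (\<lambda>i. b u (y i)) at_infinity sequentially"
    by (simp add: filterlim_at_infinity_conv_norm_at_top)
  moreover have "y i \<in> orbit_of {u}" for i
    unfolding y_def using x by (rule root_reflection_in_orbit)
  moreover have "k i *\<^sub>R y i = k i *\<^sub>R u + x i /\<^sub>R b u (x i)" for i
    using root_pairing_nonzero[OF x[of i]]
    by (simp add: k_def y_def scaleR_diff_right power2_eq_square)
  moreover have "(\<lambda>i. k i *\<^sub>R u + x i /\<^sub>R b u (x i)) \<longlonglongrightarrow> (- 0\<^sup>2 / 2) *\<^sub>R u + z"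
    unfolding k_def by (intro tendsto_intros inv0 lim) simp
  then have "(\<lambda>i. k i *\<^sub>R u + x i /\<^sub>R b u (x i)) \<longlonglongrightarrow> z" by simp
  moreover have "z \<noteq> 0" using z by (auto simp: b_simps)
  ultimately show "L \<in> limit_directions (orbit_of {u})"
    unfolding z(3) using limit_directionsI[of y _ k z] by simp
qed

text \<open>Either infinitely many orbit points of \<open>u\<close> lie in a horoball at \<open>z\<close>, and converge to \<open>z\<close>; or,
  after moving \<open>z\<close> by an element minimizing the height \<open>b(u, z)\<close>, the support of \<open>z\<close> generates a
  group that fixes \<open>z\<close> and is finite, so that it also fixes a timelike vector, which must then be
  orthogonal to \<open>z\<close>.\<close>
lemma isotropic_imaginary_cone_limit:
  assumes z: "b z z = 0" "b u z = 1"
    and cone: "\<And>us. us \<in> lists S \<Longrightarrow> act us z \<in> positive_cone"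
  shows "proj_line z \<in> limit_directions (orbit_of {u})"
proof (cases "\<exists>M. infinite {v \<in> orbit_of {u}. b v z \<le> M}")
  case True
  then obtain M where "infinite {v \<in> orbit_of {u}. b v z \<le> M}" by blast
  then obtain x :: "nat \<Rightarrow> 'v" where inj: "inj x" and x: "range x \<subseteq> {v \<in> orbit_of {u}. b v z \<le> M}"
    using infinite_countable_subset by blast
  have x_in: "x i \<in> orbit_of {u}" and xM: "b (x i) z \<le> M" for i using x by auto
  \<comment> \<open>Moving the group element over to \<open>z\<close> gives a vector of the positive
    cone, on which \<open>u\<close> is nonnegative.\<close>
  have x0: "0 \<le> b (x i) z" for i
  proof -
    obtain us where us: "us \<in> lists S" "x i = act us u"
      using x_in[of i] unfolding orbit_set_eq by blast
    then have "rev us \<in> lists S" by (auto simp: in_lists_conv_set)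
    then show ?thesis
      using us positive_cone_pairing(1)[OF cone] by (simp add: act_adjoint)
  qed
  have inf: "filterlim (\<lambda>i. b u (x i)) at_infinity sequentially"
    using u_orbit_bounded inj by (rule proper_inj_at_infinity) (use x in auto)
  obtain r y where r: "strict_mono r" and y: "(\<lambda>i. x (r i) /\<^sub>R b u (x (r i))) \<longlonglongrightarrow> y"
    "b u y = 1" "b y y = 0"
    by (rule isotropic_limit_subseq[OF inf u_orbit_norm[OF x_in]])
  have inf_r: "filterlim (\<lambda>i. b u (x (r i))) at_infinity sequentially"
    using filterlim_compose[OF inf filterlim_subseq[OF r]] .
  \<comment> \<open>The pairings with \<open>z\<close> stay between 0 and \<open>M\<close> while the
    heights grow, so \<open>y\<close> is orthogonal to \<open>z\<close> and hence equal to
    it.\<close>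
  have "(\<lambda>i. inverse (b u (x (r i))) * b (x (r i)) z) \<longlonglongrightarrow> b y z"
    using tendsto_form[OF y(1) tendsto_const[of z]] by (simp add: b_simps)
  moreover have "(\<lambda>i. inverse (b u (x (r i))) * b (x (r i)) z) \<longlonglongrightarrow> 0"
  proof (rule Lim_null_comparison)
    show "\<forall>\<^sub>F i in sequentially. norm (inverse (b u (x (r i))) * b (x (r i)) z)
      \<le> \<bar>inverse (b u (x (r i)))\<bar> * M"
      using x0 xM by (auto simp: abs_mult intro!: mult_left_mono always_eventually)
    show "(\<lambda>i. \<bar>inverse (b u (x (r i)))\<bar> * M) \<longlonglongrightarrow> 0"
      using tendsto_mult_left_zero[OF tendsto_rabs_zero[OF filterlim_compose[OF tendsto_inverse_0 inf_r]]] .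
  qed
  ultimately have "b y z = 0" using LIMSEQ_unique by blast
  then have "y = z" using isotropic_unique y z by blast
  then show ?thesis
    using x_in inf_r y(1) z(2) by (intro limit_directionsI[of "\<lambda>i. x (r i)"]) (auto simp: b_simps)
next
  case False
  \<comment> \<open>The bound 1 is the value \<open>b u z\<close>, so \<open>A\<close> contains
    \<open>u\<close>, and a minimum over the finite set \<open>A\<close> is one over the whole
    orbit.\<close>
  define A where "A = {v \<in> orbit_of {u}. b v z \<le> 1}"
  have "finite A" using False by (simp add: A_def)
  have "act [] u \<in> orbit_of {u}" by (intro mem_orbit) auto
  then have "u \<in> A" using z by (simp add: A_def)
  obtain v where v: "v \<in> A" and min: "\<And>x. x \<in> A \<Longrightarrow> b v z \<le> b x z"
    using ex_is_arg_min_if_finite[OF \<open>finite A\<close>, of "\<lambda>v. b v z"] \<open>u \<in> A\<close>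
    by (auto simp: is_arg_min_linorder)
  have min': "b v z \<le> b x z" if "x \<in> orbit_of {u}" for x
    using min[of x] v that by (cases "b x z \<le> 1") (auto simp: A_def)
  obtain us where us: "us \<in> lists S" and v_us: "v = act us u"
    using v unfolding A_def orbit_set_eq by blast
  have rev_us: "rev us \<in> lists S" using us by (auto simp: in_lists_conv_set)
  define z' where "z' = act (rev us) z"
  have adj: "b (act us y) z = b y z'" for y
    using us by (simp add: act_adjoint z'_def)
  have z'_cone: "z' \<in> positive_cone" unfolding z'_def using rev_us by (rule cone)
  have z'_iso: "b z' z' = 0" using z rev_us by (simp add: z'_def act_isometry)
  have "act us z' = z" using us by (simp add: z'_def act_cancel_rev)
  then have "z' \<noteq> 0" using z(2) linear_0[OF linear_act] by (auto simp: b_simps)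
  then have uz': "0 < b u z'" using z'_cone by (rule positive_cone_pairing(2)[rotated])
  \<comment> \<open>By minimality of \<open>v\<close>, reflecting \<open>u\<close> in
    \<open>\<alpha> s\<close> cannot lower the pairing with \<open>z'\<close>.\<close>
  have nonpos: "b z' (\<alpha> s) \<le> 0" if s: "s \<in> S" for s
  proof -
    have "act (us @ [s]) u \<in> orbit_of {u}" using us s by (intro mem_orbit) auto
    from min'[OF this] have "b u z' \<le> b (form_reflection b (\<alpha> s) u) z'"
      by (simp add: v_us adj)
    then have "b u (\<alpha> s) * b z' (\<alpha> s) \<le> 0"
      using s form_sym[of "\<alpha> s" z'] by (simp add: reflection_eq b_simps)
    then show ?thesis using u_dominant[OF s] by (simp add: mult_le_0_iff)
  qed
  define k where "k s = b z' (\<omega> s)" for s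
  have z'_eq: "z' = (\<Sum>s\<in>S. k s *\<^sub>R \<alpha> s)" unfolding k_def by (rule coordinate_expansion)
  have k: "0 \<le> k s" if "s \<in> S" for s
    using z'_cone that by (simp add: k_def mem_positive_cone_iff)
  \<comment> \<open>Since \<open>b z' z' = 0\<close> is a sum of nonpositive terms, each vanishes:
    \<open>z'\<close> is orthogonal to the simple roots in its support.\<close>
  have "(\<Sum>s\<in>S. - (k s * b z' (\<alpha> s))) = 0"
    using z'_iso b_sum_right[of z' k \<alpha> S] by (simp add: z'_eq[symmetric] sum_negf)
  moreover have "0 \<le> - (k s * b z' (\<alpha> s))" if "s \<in> S" for s
    using k[OF that] nonpos[OF that] by (simp add: mult_nonneg_nonpos)
  ultimately have compl: "k s * b z' (\<alpha> s) = 0" if "s \<in> S" for s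
    using that finite_S sum_nonneg_eq_0_iff[of S "\<lambda>s. - (k s * b z' (\<alpha> s))"] by auto
  define I where "I = {s \<in> S. k s \<noteq> 0}"
  have I: "s \<in> S" "b z' (\<alpha> s) = 0" if "s \<in> I" for s
    using that compl[of s] by (auto simp: I_def)
  have lists_I: "ws \<in> lists S" if "ws \<in> lists I" for ws
    using that I(1) by (meson lists_mono subsetD subsetI)
  have fix_z': "act ws z' = z'" if "ws \<in> lists I" for ws
    using that by (induction ws) (auto simp: reflection_eq I)
  \<comment> \<open>The orbit of \<open>u\<close> under the subgroup generated by the support of
    \<open>z'\<close>. This subgroup fixes \<open>z'\<close>, so \<open>us\<close> maps
    \<open>F\<close> into the finite set \<open>A\<close>.\<close>
  define F where "F = {act ws u | ws. ws \<in> lists I}"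
  have F_z': "b x z' = b u z'" if x: "x \<in> F" for x
  proof -
    obtain ws where ws: "ws \<in> lists I" "x = act ws u" using x unfolding F_def by blast
    then have "rev ws \<in> lists I" by (auto simp: in_lists_conv_set)
    then show ?thesis using ws lists_I fix_z' by (simp add: act_adjoint)
  qed
  have "act us ` F \<subseteq> A"
  proof
    fix y assume "y \<in> act us ` F"
    then obtain ws where ws: "ws \<in> lists I" and y: "y = act us (act ws u)"
      unfolding F_def by blast
    have "act (us @ ws) u \<in> orbit_of {u}"
      using us lists_I[OF ws] by (intro mem_orbit) auto
    moreover have "b y z = b v z"
      using ws F_z' unfolding y v_us adj F_def by blast
    ultimately show "y \<in> A" using v by (simp add: y A_def)
  qed
  moreover have "inj_on (act us) F"
    using act_rev_cancel[OF us] by (metis inj_on_inverseI)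
  ultimately have "finite F"
    using \<open>finite A\<close> finite_imageD finite_subset by metis
  \<comment> \<open>The sum is fixed by the reflections in \<open>I\<close>, hence orthogonal to
    their roots and to \<open>z'\<close>. But its pairing with \<open>z'\<close> is
    \<open>card F\<close> times the positive number \<open>b u z'\<close>.\<close>
  define y where "y = (\<Sum>x\<in>F. x)"
  have "b y (\<alpha> s) = 0" if s: "s \<in> I" for s
  proof -
    let ?\<sigma> = "form_reflection b (\<alpha> s)"
    have inv: "?\<sigma> (?\<sigma> x) = x" for x using I(1)[OF s] by (rule reflection_involution)
    have "?\<sigma> x \<in> F" if x: "x \<in> F" for x
    proof -
      obtain ws where "ws \<in> lists I" "x = act ws u" using x unfolding F_def by blast
      then have "?\<sigma> x = act (s # ws) u" "s # ws \<in> lists I" using s by auto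
      then show ?thesis unfolding F_def by blast
    qed
    then have bij: "bij_betw ?\<sigma> F F"
      using inv by (intro bij_betw_byWitness[of _ ?\<sigma>]) auto
    have "act [s] y = (\<Sum>x\<in>F. ?\<sigma> x)"
      unfolding y_def linear_sum[OF linear_act] by simp
    also have "\<dots> = y"
      unfolding y_def using sum.reindex_bij_betw[OF bij, of "\<lambda>x. x"] .
    finally have "(2 * b y (\<alpha> s)) *\<^sub>R \<alpha> s = 0"
      using I(1)[OF s] by (simp add: reflection_eq)
    moreover have "\<alpha> s \<noteq> 0" using simple_norm[OF I(1)[OF s]] by (auto simp: b_simps)
    ultimately show ?thesis by simp
  qed
  then have "k s * b y (\<alpha> s) = 0" if "s \<in> S" for s
    using that by (auto simp: I_def)
  then have "(\<Sum>s\<in>S. k s * b y (\<alpha> s)) = 0" by (intro sum.neutral ballI)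
  then have "b y z' = 0"
    by (subst z'_eq) (simp only: b_sum_right)
  moreover have "b y z' = (\<Sum>x\<in>F. 1 * b z' x)"
    unfolding y_def form_sym[of _ z'] using b_sum_right[of z' "\<lambda>_. 1" "\<lambda>x. x" F] by simp
  then have "b y z' = real (card F) * b u z'"
    using F_z' form_sym[of z'] by simp
  moreover have "act [] u \<in> F" unfolding F_def by blast
  then have "card F \<noteq> 0" using \<open>finite F\<close> by auto
  ultimately have False using uz' by simp
  then show ?thesis ..
qed

section \<open>Limit weights\<close>

lemma weight_dominant: "t \<in> S \<Longrightarrow> s \<in> S \<Longrightarrow> 0 \<le> b (\<omega> t) (\<alpha> s)"
  using fundamental_weight_pairing form_sym by (metis order_refl zero_le_one)

lemma closed_positive_cone: "closed positive_cone"
proof -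
  have "positive_cone = (\<Inter>s\<in>S. {x. 0 \<le> b x (\<omega> s)})"
    by (auto simp: mem_positive_cone_iff)
  moreover have "closed {x. 0 \<le> b x (\<omega> s)}" for s
    by (intro closed_Collect_le continuous_on_const)
      (unfold continuous_on_def, intro ballI tendsto_b tendsto_ident_at tendsto_const)
  ultimately show ?thesis by auto
qed

text \<open>A fundamental weight minus a point of its orbit lies in the positive cone. So heights of
  weights are bounded above and tend to minus infinity along the sequence; dividing by them gives
  \<open>act us z \<in> positive_cone\<close> in the limit.\<close>

lemma limit_weights_subset:
  "limit_directions (weights W S \<rho> \<alpha> b) \<subseteq> limit_directions (orbit_of {u})"
proof
  fix L assume L: "L \<in> limit_directions (weights W S \<rho> \<alpha> b)"
  have proper: "finite {x \<in> weights W S \<rho> \<alpha> b. \<bar>b u x\<bar> \<le> M}" for M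
    unfolding weights_def using finite_S weight_dominant by (intro finite_orbit_bounded) auto
  obtain M where "\<And>x. x \<in> weights W S \<rho> \<alpha> b \<Longrightarrow> \<bar>b x x\<bar> \<le> M"
    unfolding weights_def using orbit_form_bounded[of "\<omega> ` S"] finite_S by blast
  from L proper this
  obtain x :: "nat \<Rightarrow> 'v" and z where range_x: "range x \<subseteq> weights W S \<rho> \<alpha> b"
    and inf: "filterlim (\<lambda>i. b u (x i)) at_infinity sequentially"
    and lim: "(\<lambda>i. x i /\<^sub>R b u (x i)) \<longlonglongrightarrow> z"
    and z: "b u z = 1" "b z z = 0" "L = proj_line z"
    by (rule limit_directionsD)
  have x: "x i \<in> weights W S \<rho> \<alpha> b" for i using range_x by auto
  \<comment> \<open>The fundamental weight may vary with \<open>i\<close>, so the bounds are uniform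
    over all of them.\<close>
  define C where "C = (\<Sum>s\<in>S. norm (\<omega> s))"
  define C' where "C' = (\<Sum>s\<in>S. \<bar>b u (\<omega> s)\<bar>)"
  have below: "\<exists>p. norm p \<le> C \<and> b u p \<le> C' \<and> p - act us (x i) \<in> positive_cone" if us: "us \<in> lists S" for us i
  proof -
    obtain vs t where vs: "vs \<in> lists S" "t \<in> S" and xi: "x i = act vs (\<omega> t)"
      using x[of i] unfolding weights_def orbit_set_eq by blast
    have "\<omega> t - act (us @ vs) (\<omega> t) \<in> positive_cone"
      using us vs weight_dominant by (intro dominant_minus_act) auto
    moreover have "norm (\<omega> t) \<le> C"
      unfolding C_def using vs finite_S by (intro member_le_sum) auto
    moreover have "\<bar>b u (\<omega> t)\<bar> \<le> C'"
      unfolding C'_def using vs finite_S by (intro member_le_sum) auto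
    ultimately show ?thesis using xi by (intro exI[of _ "\<omega> t"]) auto
  qed
  have upper: "b u (x i) \<le> C'" for i
  proof -
    obtain p where "b u p \<le> C'" "p - act [] (x i) \<in> positive_cone" using below[of "[]" i] by auto
    then show ?thesis using positive_cone_pairing(1)[of "p - x i"] by (simp add: b_simps)
  qed
  have neg: "\<forall>\<^sub>F i in sequentially. b u (x i) < 0"
  proof -
    have "\<forall>\<^sub>F i in sequentially. C' < norm (b u (x i))"
      using inf by (simp add: filterlim_at_infinity_conv_norm_at_top filterlim_at_top_dense)
    then show ?thesis
    proof eventually_elim
      case (elim i)
      then show ?case using upper[of i] by simp
    qed
  qed
  have inv0: "(\<lambda>i. inverse (b u (x i))) \<longlonglongrightarrow> 0"
    using filterlim_compose[OF tendsto_inverse_0 inf] .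
  have "act us z \<in> positive_cone" if us: "us \<in> lists S" for us
  proof -
    obtain p where p: "\<And>i. norm (p i) \<le> C" "\<And>i. p i - act us (x i) \<in> positive_cone"
      using below[OF us] by metis
    define y where "y i = act us (x i /\<^sub>R b u (x i)) - p i /\<^sub>R b u (x i)" for i
    have "(\<lambda>i. p i /\<^sub>R b u (x i)) \<longlonglongrightarrow> 0"
    proof (rule Lim_null_comparison)
      show "\<forall>\<^sub>F i in sequentially. norm (p i /\<^sub>R b u (x i)) \<le> \<bar>inverse (b u (x i))\<bar> * C"
        using p(1) by (auto intro!: mult_left_mono always_eventually simp: abs_inverse)
      show "(\<lambda>i. \<bar>inverse (b u (x i))\<bar> * C) \<longlonglongrightarrow> 0"
        using tendsto_mult_left_zero[OF tendsto_rabs_zero[OF inv0]] .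
    qed
    moreover have "(\<lambda>i. act us (x i /\<^sub>R b u (x i))) \<longlonglongrightarrow> act us z"
      using bounded_linear.tendsto[OF linear_act[unfolded linear_conv_bounded_linear] lim] .
    ultimately have "y \<longlonglongrightarrow> act us z - 0"
      unfolding y_def by (intro tendsto_diff)
    then have "y \<longlonglongrightarrow> act us z" by simp
    moreover have "\<forall>\<^sub>F i in sequentially. y i \<in> positive_cone"
      using neg
    proof eventually_elim
      case (elim i)
      have "y i = (- inverse (b u (x i))) *\<^sub>R (p i - act us (x i))"
        by (simp add: y_def linear_cmul[OF linear_act] algebra_simps)
      then show ?case
        using positive_cone_scale[OF p(2)[of i], of "- inverse (b u (x i))"] elim by simp
    qed
    ultimately show ?thesis
      using Lim_in_closed_set[OF closed_positive_cone] by (metis sequentially_bot)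
  qed
  then show "L \<in> limit_directions (orbit_of {u})"
    unfolding z(3) by (intro isotropic_imaginary_cone_limit z)
qed

text \<open>Simple roots separate vectors by nondegeneracy, and fundamental weights because they
  read off coordinates, so \<open>limit_directions_u_subset\<close> applies to both.\<close>

theorem limit_weights_eq_limit_roots:
  "limit_directions (weights W S \<rho> \<alpha> b) = limit_directions (roots W S \<rho> \<alpha>)"
proof
  have "y = 0" if "\<And>x. x \<in> \<alpha> ` S \<Longrightarrow> b x y = 0" for y
    using nondegenerate[of y] that form_sym[of y] by simp
  then have "limit_directions (orbit_of {u}) \<subseteq> limit_directions (roots W S \<rho> \<alpha>)"
    unfolding roots_def using finite_S by (intro limit_directions_u_subset) auto
  then show "limit_directions (weights W S \<rho> \<alpha> b) \<subseteq> limit_directions (roots W S \<rho> \<alpha>)"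
    using limit_weights_subset by blast
  have "y = 0" if "\<And>x. x \<in> \<omega> ` S \<Longrightarrow> b x y = 0" for y
    using coordinate_expansion[of y] that form_sym[of y] by simp
  then have "limit_directions (orbit_of {u}) \<subseteq> limit_directions (weights W S \<rho> \<alpha> b)"
    unfolding weights_def using finite_S by (intro limit_directions_u_subset) auto
  then show "limit_directions (roots W S \<rho> \<alpha>) \<subseteq> limit_directions (weights W S \<rho> \<alpha> b)"
    using limit_roots_subset by blast
qed

end

theorem theorem3p6:
  fixes W :: "('w, 'x) monoid_scheme"
    and S :: "'w set"
    and m :: "'w \<Rightarrow> 'w \<Rightarrow> enat"
    and \<rho> :: "'w \<Rightarrow> 'v::euclidean_space \<Rightarrow> 'v"
    and c :: "'w \<Rightarrow> 'w \<Rightarrow> real"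
    and \<alpha> :: "'w \<Rightarrow> 'v"
    and b :: "'v \<Rightarrow> 'v \<Rightarrow> real"
  assumes "lorentzian_coxeter_system W S m \<rho> c \<alpha> b"
  shows "limit_directions (weights W S \<rho> \<alpha> b) = limit_directions (roots W S \<rho> \<alpha>)"
proof -
  interpret lorentzian_coxeter_system W S m \<rho> c \<alpha> b by fact
  obtain u where u: "b u u = -1" "\<And>s. s \<in> S \<Longrightarrow> 0 < b u (\<alpha> s)"
    by (rule timelike_strictly_dominant_exists) blast
  interpret timelike_coxeter_system W S m \<rho> c \<alpha> b u
    by unfold_locales (use u in auto)
  show ?thesis by (rule limit_weights_eq_limit_roots)
qed

end
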